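(* Let $n\ge2$ and let $N_1,\dots,N_n\ge2$ be integers, $M:=N_1\cdots N_n$, $Y_i:=\{1,\dots,N_i\}$, and $\mathcal Y:=Y_1\times\cdots\times Y_n$. For a permutation $\sigma\in\mathfrak S_n$ define $$\tau_{\sigma,i}:=\phi_{N_{\sigma(1)}\cdots N_{\sigma(i-1)},\,N_{\sigma(i)}}\qquad(i=2,\dots,n),$$ where $\phi_{A,B}:\{1,\dots,A\}\times\{1,\dots,B\}\to\{1,\dots,AB\}$ is the bijection $\phi_{A,B}(a,b)=B(a-1)+b$. For $(i_1,\dots,i_n)\in\mathcal Y$ and $\sigma\in\mathfrak S_n$ define $[i_1,\dots,i_n]_\sigma\in\{1,\dots,M\}$ by $$[i_1,\dots,i_n]_\sigma:=\{\tau_{\sigma,n}\circ(\tau_{\sigma,n-1}\times id)\circ\cdots\circ(\tau_{\sigma,2}\times id)\}(i_{\sigma(1)},\dots,i_{\sigma(n)}),$$ where each $\tau_{\sigma,k}\times id$ applies $\tau_{\sigma,k}$ to the first two coordinates and the identity to all remaining coordinates. For $\sigma,\eta\in\mathfrak S_n$ define the automorphism $\alpha_{\sigma,\eta}$ of $\mathcal O_M$, with canonical generators $s_1,\dots,s_M$, by $$\alpha_{\sigma,\eta}(s_{[i_1,\dots,i_n]_\eta}):=s_{[i_1,\dots,i_n]_\sigma}\qquad((i_1,\dots,i_n)\in\mathcal Y).$$ Then for any $\pi_i\in\mathrm{Rep}\,\mathcal O_{N_i}$, $i=1,\dots,n$, and any $\sigma,\eta\in\mathfrak S_n$, $$\p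i_{\sigma(1)}\otimes_\varphi\cdots\otimes_\varphi\pi_{\sigma(n)}\sim(\pi_{\eta(1)}\otimes_\varphi\cdots\otimes_\varphi\pi_{\eta(n)})\circ\alpha_{\eta,\sigma}.$$
   Context: For $N\ge2$, $\mathcal O_N$ is the Cuntz algebra: the universal C$^*$-algebra generated by $s_1,\dots,s_N$ (the canonical generators) with $s_i^*s_j=\delta_{ij}I$ and $\sum_{i=1}^N s_is_i^*=I$. $\mathrm{Rep}\,\mathcal O_N$ is the class of all unital $*$-representations of $\mathcal O_N$ on Hilbert spaces; $\sim$ means unitary equivalence. $\mathfrak S_n$ is the symmetric group on $\{1,\dots,n\}$. For $N,M\ge2$ let $t_1,\dots,t_N$, $r_1,\dots,r_M$, $s_1,\dots,s_{NM}$ be the canonical generators of $\mathcal O_N,\mathcal O_M,\mathcal O_{NM}$. The unital $*$-embedding $\varphi_{N,M}:\mathcal O_{NM}\to\mathcal O_N\otimes\mathcal O_M$ is defined by $\varphi_{N,M}(s_{M(i-1)+j})=t_i\otimes r_j$ for $i=1,\dots,N$, $j=1,\dots,M$. For $\pi_1\in\mathrm{Rep}\,\mathcal O_N$ and $\pi_2\in\mathrm{Rep}\,\mathcal O_M$, $\pi_1\otimes_\varphi\pi_2:=(\pi_1\otimes\pi_2)\circ\varphi_{N,M}\in\mathrm{Rep}\,\mathcal O_{NM}$. This operation is associative, so iterated products $\pi_1\otimes_\varphi\cdots\otimes_\varphi\pi_n$ are written without parentheses. *)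

theory Defs
  imports
    "HOL-Algebra.Algebraic_Closure_Type"
    "HOL-Algebra.Subrings"
    "HOL-Combinatorics.Permutations"
begin

text \<open>
  The Cuntz algebras, the tensor products and the Hilbert spaces below occur in families whose
  length and indices vary, so they are carrier-based structures in the style of HOL-Algebra.
\<close>

abbreviation complex_ring :: "complex ring" where
  "complex_ring \<equiv> ring_of_type_algebra"


section \<open>Normed structures\<close>

text \<open>The function \<open>nrm\<close> is the norm of the complex vector space \<open>V\<close>.\<close>

definition norm_tendsto ::
  "(complex, 'v, 'm) module_scheme \<Rightarrow> ('v \<Rightarrow> real) \<Rightarrow> (nat \<Rightarrow> 'v) \<Rightarrow> 'v \<Rightarrow> bool" where
  "norm_tendsto V nrm u x \<longleftrightarrow> (\<lambda>k. nrm (u k \<ominus>\<^bsub>V\<^esub> x)) \<longlonglongrightarrow> 0"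

definition norm_complete :: "(complex, 'v, 'm) module_scheme \<Rightarrow> ('v \<Rightarrow> real) \<Rightarrow> bool" where
  "norm_complete V nrm \<longleftrightarrow>
     (\<forall>u. (\<forall>k. u k \<in> carrier V) \<and>
          (\<forall>e>0. \<exists>n0. \<forall>k\<ge>n0. \<forall>l\<ge>n0. nrm (u k \<ominus>\<^bsub>V\<^esub> u l) < e) \<longrightarrow>
          (\<exists>x\<in>carrier V. norm_tendsto V nrm u x))"

definition norm_closed ::
  "(complex, 'v, 'm) module_scheme \<Rightarrow> ('v \<Rightarrow> real) \<Rightarrow> 'v set \<Rightarrow> bool" where
  "norm_closed V nrm W \<longleftrightarrow>
     (\<forall>u. \<forall>x\<in>carrier V. (\<forall>k. u k \<in> W) \<and> norm_tendsto V nrm u x \<longrightarrow> x \<in> W)"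

text \<open>A set is total if its linear span is dense.\<close>

definition total ::
  "(complex, 'v, 'm) module_scheme \<Rightarrow> ('v \<Rightarrow> real) \<Rightarrow> 'v set \<Rightarrow> bool" where
  "total V nrm S \<longleftrightarrow> S \<subseteq> carrier V \<and>
     (\<forall>W. submodule W complex_ring V \<and> norm_closed V nrm W \<and> S \<subseteq> W \<longrightarrow> W = carrier V)"

definition linear_on ::
  "(complex, 'v, 'm) module_scheme \<Rightarrow> (complex, 'w, 'n) module_scheme \<Rightarrow> ('v \<Rightarrow> 'w) \<Rightarrow> bool" where
  "linear_on V W f \<longleftrightarrow> f \<in> carrier V \<rightarrow> carrier W \<and>
     (\<forall>x\<in>carrier V. \<forall>y\<in>carrier V. f (x \<oplus>\<^bsub>V\<^esub> y) = f x \<oplus>\<^bsub>W\<^esub> f y) \<and>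
     (\<forall>c. \<forall>x\<in>carrier V. f (c \<odot>\<^bsub>V\<^esub> x) = c \<odot>\<^bsub>W\<^esub> f x)"

definition bilinear_on ::
  "(complex, 'u, 'm) module_scheme \<Rightarrow> (complex, 'v, 'n) module_scheme \<Rightarrow>
   (complex, 'w, 'p) module_scheme \<Rightarrow> ('u \<Rightarrow> 'v \<Rightarrow> 'w) \<Rightarrow> bool" where
  "bilinear_on U V W b \<longleftrightarrow>
     (\<forall>x\<in>carrier U. linear_on V W (b x)) \<and> (\<forall>y\<in>carrier V. linear_on U W (\<lambda>x. b x y))"


section \<open>Hilbert spaces\<close>

text \<open>
  The record type of modules in HOL-Algebra extends that of rings; the ring multiplication and the
  ring unit of a Hilbert space are not used. The inner product is linear in its second argument.
\<close>

record 'h hilbert = "(complex, 'h) module" +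
  iprod :: "'h \<Rightarrow> 'h \<Rightarrow> complex"

definition hnorm :: "'h hilbert \<Rightarrow> 'h \<Rightarrow> real" where
  "hnorm H x = sqrt (Re (iprod H x x))"

locale hilbert_space = Module.module complex_ring H
  for H :: "'h hilbert" (structure) +
  assumes iprod_add: "\<lbrakk>x \<in> carrier H; y \<in> carrier H; z \<in> carrier H\<rbrakk> \<Longrightarrow>
      iprod H x (y \<oplus>\<^bsub>H\<^esub> z) = iprod H x y + iprod H x z"
    and iprod_smult: "\<lbrakk>x \<in> carrier H; y \<in> carrier H\<rbrakk> \<Longrightarrow>
      iprod H x (c \<odot>\<^bsub>H\<^esub> y) = c * iprod H x y"
    and iprod_cnj: "\<lbrakk>x \<in> carrier H; y \<in> carrier H\<rbrakk> \<Longrightarrow> iprod H y x = cnj (iprod H x y)"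
    and iprod_nonneg: "x \<in> carrier H \<Longrightarrow> 0 \<le> Re (iprod H x x)"
    and iprod_definite: "\<lbrakk>x \<in> carrier H; iprod H x x = 0\<rbrakk> \<Longrightarrow> x = \<zero>\<^bsub>H\<^esub>"
    and hilbert_complete: "norm_complete H (hnorm H)"

definition bounded_operator :: "'h hilbert \<Rightarrow> ('h \<Rightarrow> 'h) \<Rightarrow> bool" where
  "bounded_operator H T \<longleftrightarrow> linear_on H H T \<and>
     (\<exists>C. \<forall>x\<in>carrier H. hnorm H (T x) \<le> C * hnorm H x)"

definition is_adjoint :: "'h hilbert \<Rightarrow> ('h \<Rightarrow> 'h) \<Rightarrow> ('h \<Rightarrow> 'h) \<Rightarrow> bool" where
  "is_adjoint H T S \<longleftrightarrow>
     (\<forall>x\<in>carrier H. \<forall>y\<in>carrier H. iprod H (T x) y = iprod H x (S y))"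

definition unitary :: "'h hilbert \<Rightarrow> 'k hilbert \<Rightarrow> ('h \<Rightarrow> 'k) \<Rightarrow> bool" where
  "unitary H K U \<longleftrightarrow> linear_on H K U \<and> bij_betw U (carrier H) (carrier K) \<and>
     (\<forall>x\<in>carrier H. \<forall>y\<in>carrier H. iprod K (U x) (U y) = iprod H x y)"

text \<open>
  \<open>K\<close> together with the map \<open>b\<close>, written \<open>x \<otimes> y\<close> on paper, is the Hilbert space tensor product of
  \<open>H1\<close> and \<open>H2\<close>: the completion of the algebraic tensor product for the inner product determined on
  simple tensors. It is determined up to a unique unitary compatible with simple tensors.
\<close>

definition hilbert_tensor ::
  "'h hilbert \<Rightarrow> 'h hilbert \<Rightarrow> 'h hilbert \<Rightarrow> ('h \<Rightarrow> 'h \<Rightarrow> 'h) \<Rightarrow> bool" where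
  "hilbert_tensor H1 H2 K b \<longleftrightarrow> hilbert_space K \<and> bilinear_on H1 H2 K b \<and>
     (\<forall>x\<in>carrier H1. \<forall>y\<in>carrier H2. \<forall>x'\<in>carrier H1. \<forall>y'\<in>carrier H2.
        iprod K (b x y) (b x' y') = iprod H1 x x' * iprod H2 y y') \<and>
     total K (hnorm K) {b x y |x y. x \<in> carrier H1 \<and> y \<in> carrier H2}"


section \<open>Unital C*-algebras\<close>

record 'a cstar = "(complex, 'a) module" +
  star :: "'a \<Rightarrow> 'a"
  cnorm :: "'a \<Rightarrow> real"

locale unital_cstar_algebra = Module.module complex_ring A + A?: ring A
  for A :: "'a cstar" (structure) +
  assumes smult_mult_left: "\<lbrakk>x \<in> carrier A; y \<in> carrier A\<rbrakk> \<Longrightarrow>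
      (c \<odot>\<^bsub>A\<^esub> x) \<otimes>\<^bsub>A\<^esub> y = c \<odot>\<^bsub>A\<^esub> (x \<otimes>\<^bsub>A\<^esub> y)"
    and smult_mult_right: "\<lbrakk>x \<in> carrier A; y \<in> carrier A\<rbrakk> \<Longrightarrow>
      x \<otimes>\<^bsub>A\<^esub> (c \<odot>\<^bsub>A\<^esub> y) = c \<odot>\<^bsub>A\<^esub> (x \<otimes>\<^bsub>A\<^esub> y)"
    and star_closed: "x \<in> carrier A \<Longrightarrow> star A x \<in> carrier A"
    and star_add: "\<lbrakk>x \<in> carrier A; y \<in> carrier A\<rbrakk> \<Longrightarrow>
      star A (x \<oplus>\<^bsub>A\<^esub> y) = star A x \<oplus>\<^bsub>A\<^esub> star A y"
    and star_smult: "x \<in> carrier A \<Longrightarrow> star A (c \<odot>\<^bsub>A\<^esub> x) = cnj c \<odot>\<^bsub>A\<^esub> star A x"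
    and star_mult: "\<lbrakk>x \<in> carrier A; y \<in> carrier A\<rbrakk> \<Longrightarrow>
      star A (x \<otimes>\<^bsub>A\<^esub> y) = star A y \<otimes>\<^bsub>A\<^esub> star A x"
    and star_star: "x \<in> carrier A \<Longrightarrow> star A (star A x) = x"
    and cnorm_nonneg: "x \<in> carrier A \<Longrightarrow> 0 \<le> cnorm A x"
    and cnorm_definite: "\<lbrakk>x \<in> carrier A; cnorm A x = 0\<rbrakk> \<Longrightarrow> x = \<zero>\<^bsub>A\<^esub>"
    and cnorm_triangle: "\<lbrakk>x \<in> carrier A; y \<in> carrier A\<rbrakk> \<Longrightarrow>
      cnorm A (x \<oplus>\<^bsub>A\<^esub> y) \<le> cnorm A x + cnorm A y"
    and cnorm_smult: "x \<in> carrier A \<Longrightarrow> cnorm A (c \<odot>\<^bsub>A\<^esub> x) = cmod c * cnorm A x"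
    and cnorm_mult: "\<lbrakk>x \<in> carrier A; y \<in> carrier A\<rbrakk> \<Longrightarrow>
      cnorm A (x \<otimes>\<^bsub>A\<^esub> y) \<le> cnorm A x * cnorm A y"
    and cnorm_star: "x \<in> carrier A \<Longrightarrow> cnorm A (star A x \<otimes>\<^bsub>A\<^esub> x) = (cnorm A x)\<^sup>2"
    and cstar_complete: "norm_complete A (cnorm A)"

definition cstar_subalgebra :: "'a cstar \<Rightarrow> 'a set \<Rightarrow> bool" where
  "cstar_subalgebra A B \<longleftrightarrow> subring B A \<and> submodule B complex_ring A \<and>
     (\<forall>x\<in>B. star A x \<in> B) \<and> norm_closed A (cnorm A) B"

definition star_hom :: "'a cstar \<Rightarrow> 'b cstar \<Rightarrow> ('a \<Rightarrow> 'b) \<Rightarrow> bool" where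
  "star_hom A B f \<longleftrightarrow> f \<in> ring_hom A B \<and> linear_on A B f \<and>
     (\<forall>x\<in>carrier A. f (star A x) = star B (f x))"

definition star_automorphism :: "'a cstar \<Rightarrow> ('a \<Rightarrow> 'a) \<Rightarrow> bool" where
  "star_automorphism A f \<longleftrightarrow> star_hom A A f \<and> bij_betw f (carrier A) (carrier A)"

text \<open>
  \<open>T\<close> is a C*-tensor product of \<open>A\<close> and \<open>B\<close>: the completion of the algebraic tensor product in some
  C*-norm. The last condition says that the algebraic tensor product embeds into \<open>T\<close>. For nuclear
  algebras, such as the Cuntz algebras, there is exactly one C*-norm on the algebraic tensor product.
\<close>

definition cstar_tensor ::
  "'a cstar \<Rightarrow> 'a cstar \<Rightarrow> 'a cstar \<Rightarrow> ('a \<Rightarrow> 'a \<Rightarrow> 'a) \<Rightarrow> bool" where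
  "cstar_tensor A B T t \<longleftrightarrow> unital_cstar_algebra T \<and> bilinear_on A B T t \<and>
     t \<one>\<^bsub>A\<^esub> \<one>\<^bsub>B\<^esub> = \<one>\<^bsub>T\<^esub> \<and>
     (\<forall>a\<in>carrier A. \<forall>b\<in>carrier B. \<forall>a'\<in>carrier A. \<forall>b'\<in>carrier B.
        t a b \<otimes>\<^bsub>T\<^esub> t a' b' = t (a \<otimes>\<^bsub>A\<^esub> a') (b \<otimes>\<^bsub>B\<^esub> b')) \<and>
     (\<forall>a\<in>carrier A. \<forall>b\<in>carrier B. star T (t a b) = t (star A a) (star B b)) \<and>
     total T (cnorm T) {t a b |a b. a \<in> carrier A \<and> b \<in> carrier B} \<and>
     (\<forall>(m::nat) a b. (\<forall>k<m. a k \<in> carrier A \<and> b k \<in> carrier B) \<and>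
        (\<forall>c. (\<Oplus>\<^bsub>A\<^esub>k\<in>{..<m}. c k \<odot>\<^bsub>A\<^esub> a k) = \<zero>\<^bsub>A\<^esub> \<longrightarrow> (\<forall>k<m. c k = 0)) \<and>
        (\<Oplus>\<^bsub>T\<^esub>k\<in>{..<m}. t (a k) (b k)) = \<zero>\<^bsub>T\<^esub> \<longrightarrow> (\<forall>k<m. b k = \<zero>\<^bsub>B\<^esub>))"


section \<open>Representations\<close>

type_synonym ('a, 'h) rep = "'h hilbert \<times> ('a \<Rightarrow> 'h \<Rightarrow> 'h)"

definition unital_star_rep :: "'a cstar \<Rightarrow> ('a, 'h) rep \<Rightarrow> bool" where
  "unital_star_rep A = (\<lambda>(H, \<pi>).
     hilbert_space H \<and>
     (\<forall>a\<in>carrier A. bounded_operator H (\<pi> a)) \<and>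
     (\<forall>a\<in>carrier A. \<forall>b\<in>carrier A. \<forall>x\<in>carrier H. \<pi> (a \<oplus>\<^bsub>A\<^esub> b) x = \<pi> a x \<oplus>\<^bsub>H\<^esub> \<pi> b x) \<and>
     (\<forall>c. \<forall>a\<in>carrier A. \<forall>x\<in>carrier H. \<pi> (c \<odot>\<^bsub>A\<^esub> a) x = c \<odot>\<^bsub>H\<^esub> \<pi> a x) \<and>
     (\<forall>a\<in>carrier A. \<forall>b\<in>carrier A. \<forall>x\<in>carrier H. \<pi> (a \<otimes>\<^bsub>A\<^esub> b) x = \<pi> a (\<pi> b x)) \<and>
     (\<forall>x\<in>carrier H. \<pi> \<one>\<^bsub>A\<^esub> x = x) \<and>
     (\<forall>a\<in>carrier A. is_adjoint H (\<pi> a) (\<pi> (star A a))))"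

definition unitarily_equivalent :: "'a cstar \<Rightarrow> ('a, 'h) rep \<Rightarrow> ('a, 'k) rep \<Rightarrow> bool" where
  "unitarily_equivalent A = (\<lambda>(H, \<pi>) (K, \<rho>).
     \<exists>U. unitary H K U \<and> (\<forall>a\<in>carrier A. \<forall>x\<in>carrier H. U (\<pi> a x) = \<rho> a (U x)))"

definition rep_comp :: "('a, 'h) rep \<Rightarrow> ('b \<Rightarrow> 'a) \<Rightarrow> ('b, 'h) rep" where
  "rep_comp = (\<lambda>(H, \<pi>) f. (H, \<pi> \<circ> f))"

text \<open>
  \<open>P\<close> is the tensor product of two representations, on the Hilbert space tensor product \<open>b\<close>
  and on the C*-tensor product \<open>(T, t)\<close> of \<open>A\<close> and \<open>B\<close>.
\<close>

definition rep_tensor ::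
  "'a cstar \<Rightarrow> 'a cstar \<Rightarrow> 'a cstar \<Rightarrow> ('a \<Rightarrow> 'a \<Rightarrow> 'a) \<Rightarrow> ('h \<Rightarrow> 'h \<Rightarrow> 'h) \<Rightarrow>
   ('a, 'h) rep \<Rightarrow> ('a, 'h) rep \<Rightarrow> ('a, 'h) rep \<Rightarrow> bool" where
  "rep_tensor A B T t b = (\<lambda>(H1, \<pi>1) (H2, \<pi>2) (K, P).
     hilbert_tensor H1 H2 K b \<and> unital_star_rep T (K, P) \<and>
     (\<forall>u\<in>carrier A. \<forall>v\<in>carrier B. \<forall>x\<in>carrier H1. \<forall>y\<in>carrier H2.
        P (t u v) (b x y) = b (\<pi>1 u x) (\<pi>2 v y)))"


section \<open>Cuntz algebras\<close>

definition cuntz_family :: "nat \<Rightarrow> 'a cstar \<Rightarrow> (nat \<Rightarrow> 'a) \<Rightarrow> bool" where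
  "cuntz_family N A s \<longleftrightarrow> (\<forall>i\<in>{1..N}. s i \<in> carrier A) \<and>
     (\<forall>i\<in>{1..N}. \<forall>j\<in>{1..N}. star A (s i) \<otimes>\<^bsub>A\<^esub> s j = (if i = j then \<one>\<^bsub>A\<^esub> else \<zero>\<^bsub>A\<^esub>)) \<and>
     (\<Oplus>\<^bsub>A\<^esub>i\<in>{1..N}. s i \<otimes>\<^bsub>A\<^esub> star A (s i)) = \<one>\<^bsub>A\<^esub>"

text \<open>
  \<open>A\<close> is the universal unital C*-algebra generated by the Cuntz family \<open>s\<close>. HOL cannot quantify over
  types, so universality is stated for the algebras \<open>B\<close> over the type of elements of \<open>A\<close>. This is no
  restriction: a Cuntz family generates a separable C*-algebra, of cardinality at most the
  continuum, while \<open>A\<close> itself, being non-zero, has at least the cardinality of the continuum, so every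
  algebra generated by a Cuntz family has a copy over the same type. The condition \<open>\<one> \<noteq> \<zero>\<close>
  excludes the zero algebra, which would have the universal property over a type too small for
  a non-zero C*-algebra.
\<close>

definition cuntz_algebra :: "nat \<Rightarrow> 'a cstar \<Rightarrow> (nat \<Rightarrow> 'a) \<Rightarrow> bool" where
  "cuntz_algebra N A s \<longleftrightarrow> unital_cstar_algebra A \<and> \<one>\<^bsub>A\<^esub> \<noteq> \<zero>\<^bsub>A\<^esub> \<and> cuntz_family N A s \<and>
     (\<forall>B. cstar_subalgebra A B \<and> s ` {1..N} \<subseteq> B \<longrightarrow> B = carrier A) \<and>
     (\<forall>(B :: 'a cstar) t. unital_cstar_algebra B \<and> cuntz_family N B t \<longrightarrow>
        (\<exists>!f. f \<in> extensional (carrier A) \<and> star_hom A B f \<and> (\<forall>i\<in>{1..N}. f (s i) = t i)))"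

text \<open>
  In the rest of the theory \<open>Oc N\<close> is a model of the Cuntz algebra on \<open>N\<close> generators and
  \<open>s N\<close> its family of canonical generators.
\<close>

definition pair_index :: "nat \<Rightarrow> nat \<Rightarrow> nat \<Rightarrow> nat \<Rightarrow> nat" where
  "pair_index A B a b = B * (a - 1) + b"

text \<open>
  \<open>(T, t)\<close> is a C*-tensor product of \<open>Oc N\<close> and \<open>Oc M\<close>. Since the images of the generators form a
  Cuntz family in \<open>T\<close>, the map exists uniquely by the universal property of \<open>Oc (N * M)\<close>.
\<close>

definition phi_embedding ::
  "(nat \<Rightarrow> 'a cstar) \<Rightarrow> (nat \<Rightarrow> nat \<Rightarrow> 'a) \<Rightarrow> nat \<Rightarrow> nat \<Rightarrow> 'a cstar \<Rightarrow> ('a \<Rightarrow> 'a \<Rightarrow> 'a) \<Rightarrow> 'a \<Rightarrow> 'a"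
where
  "phi_embedding Oc s N M T t =
     (THE f. f \<in> extensional (carrier (Oc (N * M))) \<and> star_hom (Oc (N * M)) T f \<and>
        (\<forall>i\<in>{1..N}. \<forall>j\<in>{1..M}. f (s (N * M) (M * (i - 1) + j)) = t (s N i) (s M j)))"

text \<open>
  \<open>R\<close> is the product of \<open>R1\<close> and \<open>R2\<close>, i.e. their tensor product composed with the embedding above.
  It is a relation since the tensor products are only determined up to isomorphism. That the
  tensor products live over the same types as the factors is no restriction, because up to
  isomorphism their cardinalities do not exceed the larger of those of the factors.
\<close>

definition phi_tensor ::
  "(nat \<Rightarrow> 'a cstar) \<Rightarrow> (nat \<Rightarrow> nat \<Rightarrow> 'a) \<Rightarrow> nat \<Rightarrow> nat \<Rightarrow>
   ('a, 'h) rep \<Rightarrow> ('a, 'h) rep \<Rightarrow> ('a, 'h) rep \<Rightarrow> bool" where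
  "phi_tensor Oc s N M R1 R2 R \<longleftrightarrow>
     (\<exists>T t b P. cstar_tensor (Oc N) (Oc M) T t \<and> rep_tensor (Oc N) (Oc M) T t b R1 R2 P \<and>
        R = rep_comp P (phi_embedding Oc s N M T t))"

text \<open>
  Iterated products, bracketed to the left. An entry \<open>(N, R)\<close> stands for a
  representation \<open>R\<close> of \<open>Oc N\<close>.
\<close>

inductive phi_product ::
  "(nat \<Rightarrow> 'a cstar) \<Rightarrow> (nat \<Rightarrow> nat \<Rightarrow> 'a) \<Rightarrow> (nat \<times> ('a, 'h) rep) list \<Rightarrow> nat \<times> ('a, 'h) rep \<Rightarrow> bool"
  for Oc :: "nat \<Rightarrow> 'a cstar" and s :: "nat \<Rightarrow> nat \<Rightarrow> 'a"
where
  single: "phi_product Oc s [(N, R)] (N, R)"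
| snoc: "\<lbrakk>phi_product Oc s Rs (N, R1); phi_tensor Oc s N M R1 R2 R\<rbrakk> \<Longrightarrow>
    phi_product Oc s (Rs @ [(M, R2)]) (N * M, R)"


section \<open>Multi-indices and permutations\<close>

definition tau :: "(nat \<Rightarrow> nat) \<Rightarrow> (nat \<Rightarrow> nat) \<Rightarrow> nat \<Rightarrow> nat \<Rightarrow> nat \<Rightarrow> nat" where
  "tau N \<sigma> k = pair_index (\<Prod>j=1..k-1. N (\<sigma> j)) (N (\<sigma> k))"

fun apply_first_two :: "('b \<Rightarrow> 'b \<Rightarrow> 'b) \<Rightarrow> 'b list \<Rightarrow> 'b list" where
  "apply_first_two f (a # b # xs) = f a b # xs"
| "apply_first_two f xs = xs"

text \<open>
  \<open>fold\<close> applies the maps for \<open>k = 2, \<dots>, n\<close> in this order and leaves a list of length one.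
\<close>

definition multi_index ::
  "(nat \<Rightarrow> nat) \<Rightarrow> nat \<Rightarrow> (nat \<Rightarrow> nat) \<Rightarrow> (nat \<Rightarrow> nat) \<Rightarrow> nat" where
  "multi_index N n \<sigma> i =
     hd (fold (\<lambda>k. apply_first_two (tau N \<sigma> k)) [2..<n+1] (map (\<lambda>k. i (\<sigma> k)) [1..<n+1]))"

definition alpha ::
  "'a cstar \<Rightarrow> (nat \<Rightarrow> 'a) \<Rightarrow> (nat \<Rightarrow> nat) \<Rightarrow> nat \<Rightarrow> (nat \<Rightarrow> nat) \<Rightarrow> (nat \<Rightarrow> nat) \<Rightarrow> 'a \<Rightarrow> 'a" where
  "alpha A s N n \<sigma> \<eta> =
     (THE f. f \<in> extensional (carrier A) \<and> star_automorphism A f \<and>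
        (\<forall>i \<in> (\<Pi>\<^sub>E k\<in>{1..n}. {1..N k}).
           f (s (multi_index N n \<eta> i)) = s (multi_index N n \<sigma> i)))"

end

theory Submission
  imports Defs
begin

text \<open>
  An iterated product acts on a Hilbert space spanned by multiple tensors, on which the generators
  act factor by factor. Reordering the factors does not change the Gram matrix of these tensors, so
  there is a unitary between the two products which permutes the tensor factors. It intertwines the
  images of the generators up to relabelling, and the relabelling is the automorphism. The elements
  for which it intertwines the two representations form a C*-subalgebra; that this set is closed
  requires representations to be norm continuous, which follows from the existence of
  square roots of \<open>1 - c\<close> for small self-adjoint \<open>c\<close>.
\<close>

text \<open>The universal property in \<open>cuntz_algebra\<close> only concerns algebras over the
  element type of the Cuntz algebra, whereas operators on a Hilbert space are functions on another
  type. Two representations that agree on the generators therefore cannot be compared by its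
  uniqueness clause, and generation as a C*-algebra takes its place; this is what makes continuity
  of representations an issue. As \<open>unital_star_rep\<close> bounds each operator separately, a
  bound in terms of \<open>cnorm\<close> has to be derived.

  Tensor products are given by relations, without a chosen model. What is retained of an iterated
  product is a map from tuples of vectors into the product space, the Gram matrix of its values, and
  the action of the generators on them. Tuples are functions on the factor numbers, so a permutation
  acts on them by composition, and both products can be indexed by the same set of tuples.\<close>

lemma complex_ring_simps [simp]:
  "carrier complex_ring = UNIV"
  "x \<otimes>\<^bsub>complex_ring\<^esub> y = x * y"
  "x \<oplus>\<^bsub>complex_ring\<^esub> y = x + y"
  "\<one>\<^bsub>complex_ring\<^esub> = 1"
  "\<zero>\<^bsub>complex_ring\<^esub> = 0"
  by (simp_all add: ring_of_type_algebra_def)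

lemma (in abelian_group) minus_add_add:
  assumes "a \<in> carrier G" "b \<in> carrier G" "c \<in> carrier G" "d \<in> carrier G"
  shows "(a \<oplus>\<^bsub>G\<^esub> b) \<ominus>\<^bsub>G\<^esub> (c \<oplus>\<^bsub>G\<^esub> d) = (a \<ominus>\<^bsub>G\<^esub> c) \<oplus>\<^bsub>G\<^esub> (b \<ominus>\<^bsub>G\<^esub> d)"
  using assms by (simp add: minus_eq minus_add a_ac)

lemma (in abelian_group) uminus_zero: "\<ominus>\<^bsub>G\<^esub> \<zero>\<^bsub>G\<^esub> = \<zero>\<^bsub>G\<^esub>"
  by (rule minus_equality) simp_all

lemma (in abelian_group) minus_eq_zero_iff:
  assumes "x \<in> carrier G" "y \<in> carrier G"
  shows "x \<ominus>\<^bsub>G\<^esub> y = \<zero>\<^bsub>G\<^esub> \<longleftrightarrow> x = y"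
proof
  assume "x \<ominus>\<^bsub>G\<^esub> y = \<zero>\<^bsub>G\<^esub>"
  then show "x = y"
    using assms minus_equality[of x "\<ominus>\<^bsub>G\<^esub> y"] by (simp add: minus_eq)
qed (use assms in \<open>simp add: minus_eq r_neg\<close>)

section \<open>Normed modules\<close>

text \<open>The common ground of Hilbert spaces and C*-algebras, both of which become instances
  below, so that limits and density are treated once. The norm is a parameter because it is
  \<open>hnorm H\<close> in one case and \<open>cnorm A\<close> in the other.\<close>

locale normed_module = Module.module complex_ring V
  for V :: "(complex, 'v, 'm) module_scheme" (structure) +
  fixes nrm :: "'v \<Rightarrow> real"
  assumes nrm_nonneg: "x \<in> carrier V \<Longrightarrow> 0 \<le> nrm x"
    and nrm_definite: "\<lbrakk>x \<in> carrier V; nrm x = 0\<rbrakk> \<Longrightarrow> x = \<zero>"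
    and nrm_triangle: "\<lbrakk>x \<in> carrier V; y \<in> carrier V\<rbrakk> \<Longrightarrow> nrm (x \<oplus> y) \<le> nrm x + nrm y"
    and nrm_smult: "x \<in> carrier V \<Longrightarrow> nrm (c \<odot> x) = cmod c * nrm x"
begin

lemmas smult_zero_left [simp] = smult_l_null[simplified]
  and smult_one_left [simp] = smult_one[simplified]
  and smult_add_left = smult_l_distr[simplified]

lemma uminus_eq_smult: "x \<in> carrier V \<Longrightarrow> \<ominus> x = (- 1) \<odot> x"
  using smult_add_left[of x "- 1" 1] by (simp add: minus_equality)

lemma nrm_zero [simp]: "nrm \<zero> = 0"
  using nrm_smult[of \<zero> 0] by simp

lemma nrm_uminus: "x \<in> carrier V \<Longrightarrow> nrm (\<ominus> x) = nrm x"
  by (simp add: uminus_eq_smult nrm_smult)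

lemma nrm_minus_commute:
  "\<lbrakk>x \<in> carrier V; y \<in> carrier V\<rbrakk> \<Longrightarrow> nrm (x \<ominus> y) = nrm (y \<ominus> x)"
  using nrm_uminus[of "x \<ominus> y"] by (simp add: minus_eq minus_add a_comm)

lemma nrm_minus_triangle:
  assumes "x \<in> carrier V" "y \<in> carrier V" "z \<in> carrier V"
  shows "nrm (x \<ominus> z) \<le> nrm (x \<ominus> y) + nrm (y \<ominus> z)"
proof -
  have "x \<ominus> z = (x \<ominus> y) \<oplus> (y \<ominus> z)"
    using assms by (simp add: minus_eq a_assoc r_neg1)
  then show ?thesis
    using assms nrm_triangle[of "x \<ominus> y" "y \<ominus> z"] by simp
qed

lemma nrm_minus_eq_0_iff:
  "\<lbrakk>x \<in> carrier V; y \<in> carrier V\<rbrakk> \<Longrightarrow> nrm (x \<ominus> y) = 0 \<longleftrightarrow> x = y"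
  using nrm_definite[of "x \<ominus> y"] minus_eq_zero_iff[of x y] by auto

lemma norm_tendsto_unique:
  assumes "norm_tendsto V nrm u x" "norm_tendsto V nrm u y"
    and "\<And>k. u k \<in> carrier V" "x \<in> carrier V" "y \<in> carrier V"
  shows "x = y"
proof -
  have "(\<lambda>k. nrm (u k \<ominus> x) + nrm (u k \<ominus> y)) \<longlonglongrightarrow> 0 + 0"
    using assms(1,2) unfolding norm_tendsto_def by (rule tendsto_add)
  moreover have "nrm (x \<ominus> y) \<le> nrm (u k \<ominus> x) + nrm (u k \<ominus> y)" for k
    using assms(3-5) nrm_minus_triangle[of x "u k" y] nrm_minus_commute[of x "u k"] by simp
  ultimately have "nrm (x \<ominus> y) \<le> 0 + 0"
    by (intro LIMSEQ_le_const[of _ "0 + 0"]) auto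
  then show ?thesis
    using assms(4,5) nrm_nonneg[of "x \<ominus> y"] nrm_minus_eq_0_iff[of x y] by simp
qed

lemma norm_tendsto_cauchy:
  assumes "norm_tendsto V nrm u x" "\<And>k. u k \<in> carrier V" "x \<in> carrier V" "e > 0"
  shows "\<exists>n0. \<forall>k\<ge>n0. \<forall>l\<ge>n0. nrm (u k \<ominus> u l) < e"
proof -
  obtain n0 where n0: "\<And>k. k \<ge> n0 \<Longrightarrow> norm (nrm (u k \<ominus> x) - 0) < e / 2"
    using LIMSEQ_D[OF assms(1)[unfolded norm_tendsto_def], of "e / 2"] assms(4) by auto
  have "nrm (u k \<ominus> u l) < e" if "k \<ge> n0" "l \<ge> n0" for k l
    using n0[OF that(1)] n0[OF that(2)] nrm_minus_triangle[of "u k" x "u l"]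
      nrm_minus_commute[of x "u l"] assms(2,3) by (simp add: nrm_nonneg)
  then show ?thesis by blast
qed

end

section \<open>Linear maps between modules\<close>

lemma linear_on_closed [intro]: "\<lbrakk>linear_on V W f; x \<in> carrier V\<rbrakk> \<Longrightarrow> f x \<in> carrier W"
  and linear_on_add: "\<lbrakk>linear_on V W f; x \<in> carrier V; y \<in> carrier V\<rbrakk> \<Longrightarrow>
    f (x \<oplus>\<^bsub>V\<^esub> y) = f x \<oplus>\<^bsub>W\<^esub> f y"
  and linear_on_smult: "\<lbrakk>linear_on V W f; x \<in> carrier V\<rbrakk> \<Longrightarrow> f (c \<odot>\<^bsub>V\<^esub> x) = c \<odot>\<^bsub>W\<^esub> f x"
  by (auto simp: linear_on_def)

lemma linear_on_zero:
  assumes "Module.module complex_ring V" "Module.module complex_ring W" "linear_on V W f"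
  shows "f \<zero>\<^bsub>V\<^esub> = \<zero>\<^bsub>W\<^esub>"
proof -
  interpret V: Module.module complex_ring V by fact
  interpret W: Module.module complex_ring W by fact
  show ?thesis
    using linear_on_smult[OF assms(3), of "\<zero>\<^bsub>V\<^esub>" 0] linear_on_closed[OF assms(3), of "\<zero>\<^bsub>V\<^esub>"]
      V.smult_l_null[of "\<zero>\<^bsub>V\<^esub>"] W.smult_l_null[of "f \<zero>\<^bsub>V\<^esub>"] by simp
qed

lemma linear_on_uminus:
  assumes "Module.module complex_ring V" "Module.module complex_ring W" "linear_on V W f"
    and "x \<in> carrier V"
  shows "f (\<ominus>\<^bsub>V\<^esub> x) = \<ominus>\<^bsub>W\<^esub> f x"
proof -
  interpret V: Module.module complex_ring V by fact
  interpret W: Module.module complex_ring W by fact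
  have "f (\<ominus>\<^bsub>V\<^esub> x) \<oplus>\<^bsub>W\<^esub> f x = \<zero>\<^bsub>W\<^esub>"
    using linear_on_add[OF assms(3), of "\<ominus>\<^bsub>V\<^esub> x" x] linear_on_zero[OF assms(1-3)] assms(4)
    by (simp add: V.l_neg)
  then show ?thesis
    using W.minus_equality[of "f (\<ominus>\<^bsub>V\<^esub> x)" "f x"] assms(4)
      linear_on_closed[OF assms(3), of "\<ominus>\<^bsub>V\<^esub> x"] linear_on_closed[OF assms(3), of x] by simp
qed

lemma linear_on_minus:
  assumes "Module.module complex_ring V" "Module.module complex_ring W" "linear_on V W f"
    and "x \<in> carrier V" "y \<in> carrier V"
  shows "f (x \<ominus>\<^bsub>V\<^esub> y) = f x \<ominus>\<^bsub>W\<^esub> f y"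
proof -
  interpret V: Module.module complex_ring V by fact
  interpret W: Module.module complex_ring W by fact
  show ?thesis
    using assms(4,5)
    by (simp add: V.minus_eq W.minus_eq linear_on_add[OF assms(3)] linear_on_uminus[OF assms(1-3)])
qed

lemma linear_on_finsum:
  assumes "Module.module complex_ring V" "Module.module complex_ring W" "linear_on V W f"
    and "finite I" "g \<in> I \<rightarrow> carrier V"
  shows "f (\<Oplus>\<^bsub>V\<^esub>i\<in>I. g i) = (\<Oplus>\<^bsub>W\<^esub>i\<in>I. f (g i))"
  using assms(4,5)
proof (induction I rule: finite_induct)
  interpret V: Module.module complex_ring V by fact
  interpret W: Module.module complex_ring W by fact
  case empty
  show ?case by (simp add: linear_on_zero[OF assms(1-3)])
next
  interpret V: Module.module complex_ring V by fact
  interpret W: Module.module complex_ring W by fact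
  case (insert i I)
  have "(\<lambda>i. f (g i)) \<in> I \<rightarrow> carrier W" "f (g i) \<in> carrier W"
    using insert.prems assms(3) by auto
  with insert show ?case
    by (simp add: V.finsum_insert W.finsum_insert linear_on_add[OF assms(3)] Pi_iff)
qed

text \<open>The ratio 1/2 is the contraction rate of the iteration that produces square
  roots.\<close>

lemma (in normed_module) geometric_limit:
  assumes "norm_complete V nrm" and u: "\<And>k. u k \<in> carrier V"
    and step: "\<And>k. nrm (u (Suc k) \<ominus> u k) \<le> C * (1 / 2) ^ k"
  obtains x where "x \<in> carrier V" "norm_tendsto V nrm u x"
proof -
  \<comment> \<open>The subtracted power makes the induction close, since it absorbs the next step
    exactly. Dropping it afterwards leaves \<open>2 * C * (1 / 2) ^ k\<close>.\<close>
  have bound: "nrm (u (k + m) \<ominus> u k) \<le> 2 * C * ((1 / 2) ^ k - (1 / 2) ^ (k + m))" for k m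
  proof (induction m)
    case 0
    then show ?case by (simp add: minus_eq r_neg u)
  next
    case (Suc m)
    have "nrm (u (Suc (k + m)) \<ominus> u k) \<le> nrm (u (Suc (k + m)) \<ominus> u (k + m)) + nrm (u (k + m) \<ominus> u k)"
      by (rule nrm_minus_triangle) (rule u)+
    with Suc step[of "k + m"] show ?case by (simp add: algebra_simps)
  qed
  have C: "C \<ge> 0" using step[of 0] nrm_nonneg[of "u (Suc 0) \<ominus> u 0"] u by simp
  have tail: "nrm (u l \<ominus> u k) \<le> 2 * C * (1 / 2) ^ k" if "k \<le> l" for k l
  proof -
    have "2 * C * ((1 / 2) ^ k - (1 / 2) ^ (k + (l - k))) \<le> 2 * C * (1 / 2 :: real) ^ k"
      using C by (intro mult_left_mono) auto
    then show ?thesis using bound[of k "l - k"] that by simp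
  qed
  have "\<exists>n0. \<forall>k\<ge>n0. \<forall>l\<ge>n0. nrm (u k \<ominus> u l) < e" if "e > 0" for e
  proof -
    have "(\<lambda>k. 2 * C * (1 / 2 :: real) ^ k) \<longlonglongrightarrow> 0"
      by (intro tendsto_mult_right_zero LIMSEQ_realpow_zero) auto
    from LIMSEQ_D[OF this \<open>e > 0\<close>] obtain n0 where n0: "\<And>k. k \<ge> n0 \<Longrightarrow> 2 * C * (1 / 2 :: real) ^ k < e"
      using C by auto
    have "nrm (u k \<ominus> u l) < e" if "k \<ge> n0" "l \<ge> n0" for k l
      using tail[of k l] tail[of l k] n0[OF that(1)] n0[OF that(2)]
        nrm_minus_commute[OF u[of k] u[of l]] by (cases "k \<le> l") auto
    then show ?thesis by blast
  qed
  then obtain x where "x \<in> carrier V" "norm_tendsto V nrm u x"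
    using assms(1)[unfolded norm_complete_def, rule_format, of u] u by blast
  then show ?thesis by (rule that)
qed

section \<open>Closed submodules and density\<close>

definition closed_submodule ::
  "(complex, 'v, 'm) module_scheme \<Rightarrow> ('v \<Rightarrow> real) \<Rightarrow> 'v set \<Rightarrow> bool" where
  "closed_submodule V nrm W \<longleftrightarrow> submodule W complex_ring V \<and> norm_closed V nrm W"

text \<open>The induction principle for a total set: a property holds for all vectors once the
  vectors having it form a closed submodule that contains the set.\<close>

lemma total_closed_submodule:
  assumes "total V nrm S" "closed_submodule V nrm W" "S \<subseteq> W"
  shows "W = carrier V"
  using assms by (auto simp: total_def closed_submodule_def)

context normed_module
begin

lemma submodule_zero: "submodule W complex_ring V \<Longrightarrow> \<zero> \<in> W"
  using subgroup.one_closed[of W "add_monoid V"] by (simp add: submodule_def)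

lemma closed_submoduleI:
  assumes "W \<subseteq> carrier V" "\<zero> \<in> W"
    and "\<And>x y. \<lbrakk>x \<in> W; y \<in> W\<rbrakk> \<Longrightarrow> x \<oplus> y \<in> W"
    and "\<And>c x. x \<in> W \<Longrightarrow> c \<odot> x \<in> W"
    and "\<And>u x. \<lbrakk>\<And>k. u k \<in> W; norm_tendsto V nrm u x; x \<in> carrier V\<rbrakk> \<Longrightarrow> x \<in> W"
  shows "closed_submodule V nrm W"
  unfolding closed_submodule_def
proof
  show "submodule W complex_ring V"
    by (rule submoduleI) (use assms in \<open>auto simp: uminus_eq_smult subset_iff\<close>)
  show "norm_closed V nrm W"
    using assms(5) by (auto simp: norm_closed_def)
qed

lemma closed_submodule_singleton_zero: "closed_submodule V nrm {\<zero>}"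
proof (rule closed_submoduleI)
  fix u x assume "\<And>k. u k \<in> {\<zero>}" "norm_tendsto V nrm u x" "x \<in> carrier V"
  moreover have "norm_tendsto V nrm (\<lambda>k. \<zero>) \<zero>"
    by (simp add: norm_tendsto_def minus_eq uminus_zero)
  moreover have "u = (\<lambda>k. \<zero>)" using calculation(1) by auto
  ultimately show "x \<in> {\<zero>}"
    using norm_tendsto_unique[of "\<lambda>k. \<zero>" x \<zero>] by simp
qed auto

end

lemma norm_tendsto_linear:
  assumes V: "normed_module V n" and W: "normed_module W m" and f: "linear_on V W f"
    and C: "\<And>x. x \<in> carrier V \<Longrightarrow> m (f x) \<le> C * n x"
    and u: "norm_tendsto V n u x" "\<And>k. u k \<in> carrier V" "x \<in> carrier V"
  shows "norm_tendsto W m (\<lambda>k. f (u k)) (f x)"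
proof -
  interpret V: normed_module V n by fact
  interpret W: normed_module W m by fact
  note mods = V.module_axioms W.module_axioms
  have "m (f (u k) \<ominus>\<^bsub>W\<^esub> f x) \<le> C * n (u k \<ominus>\<^bsub>V\<^esub> x)" for k
    using C[of "u k \<ominus>\<^bsub>V\<^esub> x"] u(2,3) by (simp add: linear_on_minus[OF mods f])
  moreover have "0 \<le> m (f (u k) \<ominus>\<^bsub>W\<^esub> f x)" for k
    using f u(2,3) by (intro W.nrm_nonneg W.minus_closed) auto
  moreover have "(\<lambda>k. C * n (u k \<ominus>\<^bsub>V\<^esub> x)) \<longlonglongrightarrow> 0"
    using tendsto_mult_right_zero u(1) unfolding norm_tendsto_def by blast
  ultimately show ?thesis
    unfolding norm_tendsto_def
    by (elim tendsto_0_le[where K = 1], intro always_eventually) (auto intro: order_trans[OF _ abs_ge_self])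
qed

lemma closed_submodule_vimage:
  assumes V: "normed_module V n" and W: "normed_module W m" and f: "linear_on V W f"
    and C: "\<And>x. x \<in> carrier V \<Longrightarrow> m (f x) \<le> C * n x"
    and Z: "closed_submodule W m Z"
  shows "closed_submodule V n {x \<in> carrier V. f x \<in> Z}"
proof -
  interpret V: normed_module V n by fact
  interpret W: normed_module W m by fact
  have Z': "submodule Z complex_ring W" "norm_closed W m Z"
    using Z by (auto simp: closed_submodule_def)
  show ?thesis
  proof (rule V.closed_submoduleI)
    show "\<zero>\<^bsub>V\<^esub> \<in> {x \<in> carrier V. f x \<in> Z}"
      using W.submodule_zero[OF Z'(1)] linear_on_zero[OF V.module_axioms W.module_axioms f] by simp
  next
    fix u x
    assume u: "\<And>k. u k \<in> {x \<in> carrier V. f x \<in> Z}" and x: "norm_tendsto V n u x" "x \<in> carrier V"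
    then have "norm_tendsto W m (\<lambda>k. f (u k)) (f x)"
      by (intro norm_tendsto_linear[OF V W f C]) auto
    moreover have "f x \<in> carrier W" using f x by auto
    ultimately have "f x \<in> Z"
      using Z'(2)[unfolded norm_closed_def, rule_format, where u = "\<lambda>k. f (u k)" and x = "f x"] u
      by auto
    then show "x \<in> {x \<in> carrier V. f x \<in> Z}" using x by simp
  qed (use f W.submoduleE(4,5)[OF Z'(1)] in \<open>auto simp: linear_on_add linear_on_smult\<close>)
qed

text \<open>The equaliser of \<open>f\<close> and \<open>g\<close> is the preimage of zero under
  their difference. This difference is bounded by \<open>C + D\<close>, so the preimage is a closed
  submodule.\<close>

lemma linear_eq_on_total:
  assumes V: "normed_module V n" and W: "normed_module W m"
    and f: "linear_on V W f" "\<And>x. x \<in> carrier V \<Longrightarrow> m (f x) \<le> C * n x"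
    and g: "linear_on V W g" "\<And>x. x \<in> carrier V \<Longrightarrow> m (g x) \<le> D * n x"
    and S: "total V n S" "\<And>x. x \<in> S \<Longrightarrow> f x = g x"
    and x: "x \<in> carrier V"
  shows "f x = g x"
proof -
  interpret V: normed_module V n by fact
  interpret W: normed_module W m by fact
  let ?h = "\<lambda>x. f x \<ominus>\<^bsub>W\<^esub> g x"
  have closed: "f x \<in> carrier W" "g x \<in> carrier W" if "x \<in> carrier V" for x
    using f g that by auto
  have h: "linear_on V W ?h"
    unfolding linear_on_def
  proof (intro conjI ballI allI)
    fix x y assume "x \<in> carrier V" "y \<in> carrier V"
    then show "f (x \<oplus>\<^bsub>V\<^esub> y) \<ominus>\<^bsub>W\<^esub> g (x \<oplus>\<^bsub>V\<^esub> y) = (f x \<ominus>\<^bsub>W\<^esub> g x) \<oplus>\<^bsub>W\<^esub> (f y \<ominus>\<^bsub>W\<^esub> g y)"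
      by (simp add: linear_on_add[OF f(1)] linear_on_add[OF g(1)] W.minus_add_add closed)
  next
    fix c x assume "x \<in> carrier V"
    then show "f (c \<odot>\<^bsub>V\<^esub> x) \<ominus>\<^bsub>W\<^esub> g (c \<odot>\<^bsub>V\<^esub> x) = c \<odot>\<^bsub>W\<^esub> (f x \<ominus>\<^bsub>W\<^esub> g x)"
      by (simp add: linear_on_smult[OF f(1)] linear_on_smult[OF g(1)] W.minus_eq W.smult_r_distr
          W.smult_r_minus closed)
  qed (use closed in auto)
  have C: "m (?h x) \<le> (C + D) * n x" if "x \<in> carrier V" for x
    using W.nrm_triangle[of "f x" "\<ominus>\<^bsub>W\<^esub> g x"] f(2)[OF that] g(2)[OF that]
    by (simp add: closed that W.minus_eq W.nrm_uminus algebra_simps)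
  have "{x \<in> carrier V. ?h x \<in> {\<zero>\<^bsub>W\<^esub>}} = carrier V"
  proof (rule total_closed_submodule[OF S(1)])
    show "S \<subseteq> {x \<in> carrier V. ?h x \<in> {\<zero>\<^bsub>W\<^esub>}}"
      using S closed by (auto simp: total_def W.minus_eq W.r_neg)
  qed (rule closed_submodule_vimage[OF V W h C W.closed_submodule_singleton_zero])
  then have "?h x = \<zero>\<^bsub>W\<^esub>" using x by blast
  then show ?thesis using closed[OF x] W.minus_eq_zero_iff by blast
qed

section \<open>Hilbert spaces\<close>

context hilbert_space
begin

lemma iprod_add_left:
  assumes "x \<in> carrier H" "y \<in> carrier H" "z \<in> carrier H"
  shows "iprod H (x \<oplus> y) z = iprod H x z + iprod H y z"
  using assms iprod_cnj[of z] iprod_add[of z x y] by simp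

lemma iprod_smult_left:
  assumes "x \<in> carrier H" "y \<in> carrier H"
  shows "iprod H (c \<odot> x) y = cnj c * iprod H x y"
  using assms iprod_cnj[of y "c \<odot> x"] iprod_cnj[of y x] iprod_smult[of y x c] by simp

lemma iprod_self: "x \<in> carrier H \<Longrightarrow> iprod H x x = of_real ((hnorm H x)\<^sup>2)"
  using iprod_cnj[of x x] iprod_nonneg[of x] by (simp add: hnorm_def complex_eq_iff)

lemma hnorm_nonneg: "x \<in> carrier H \<Longrightarrow> 0 \<le> hnorm H x"
  using iprod_nonneg by (simp add: hnorm_def)

lemma hnorm_definite: "\<lbrakk>x \<in> carrier H; hnorm H x = 0\<rbrakk> \<Longrightarrow> x = \<zero>"
  using iprod_definite[of x] iprod_self[of x] by simp

lemma hnorm_smult: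
  assumes x: "x \<in> carrier H"
  shows "hnorm H (c \<odot> x) = cmod c * hnorm H x"
proof -
  have "complex_of_real ((hnorm H (c \<odot> x))\<^sup>2) = of_real ((cmod c * hnorm H x)\<^sup>2)"
    using x iprod_self[of "c \<odot> x"] iprod_self[of x] complex_norm_square[of c]
    by (simp add: iprod_smult iprod_smult_left power_mult_distrib mult.assoc)
  then show ?thesis
    using x by (simp add: hnorm_nonneg power2_eq_iff_nonneg del: of_real_power of_real_mult)
qed

lemma cauchy_schwarz:
  assumes x: "x \<in> carrier H" and y: "y \<in> carrier H"
  shows "cmod (iprod H x y) \<le> hnorm H x * hnorm H y"
proof (cases "hnorm H y = 0")
  case True
  then have "y = \<zero>" using hnorm_definite y by blast
  then have "iprod H x y = 0"
    using iprod_smult[of x \<zero> 0] x smult_l_null[of \<zero>] by simp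
  with True show ?thesis by simp
next
  case False
  define z where "z = iprod H x y"
  define a b where "a = (hnorm H x)\<^sup>2" and "b = (hnorm H y)\<^sup>2"
  have b: "b > 0" using False by (simp add: b_def)
  \<comment> \<open>This is \<open>b\<close> times the component of \<open>x\<close> orthogonal to
    \<open>y\<close>; the factor \<open>b\<close> avoids a division.\<close>
  let ?v = "complex_of_real b \<odot> x \<oplus> (- cnj z) \<odot> y"
  have xy: "iprod H x x = of_real a" "iprod H y y = of_real b" "iprod H x y = z" "iprod H y x = cnj z"
    using x y iprod_self iprod_cnj[of x y] by (auto simp: a_def b_def z_def)
  have "(complex_of_real (cmod z))\<^sup>2 = z * cnj z"
    using complex_norm_square[of z] by simp
  then have "iprod H ?v ?v = of_real (b * (a * b - (cmod z)\<^sup>2))"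
    using x y
    by (simp add: iprod_add iprod_add_left iprod_smult iprod_smult_left xy algebra_simps)
  then have "0 \<le> b * (a * b - (cmod z)\<^sup>2)"
    using iprod_nonneg[of ?v] x y by simp
  then have "(cmod z)\<^sup>2 \<le> (hnorm H x * hnorm H y)\<^sup>2"
    using b by (simp add: zero_le_mult_iff a_def b_def power_mult_distrib)
  then show ?thesis
    using x y hnorm_nonneg by (simp add: z_def power2_le_iff_abs_le)
qed

lemma hnorm_triangle:
  assumes x: "x \<in> carrier H" and y: "y \<in> carrier H"
  shows "hnorm H (x \<oplus> y) \<le> hnorm H x + hnorm H y"
proof -
  have "complex_of_real ((hnorm H (x \<oplus> y))\<^sup>2) =
      of_real ((hnorm H x)\<^sup>2) + iprod H x y + cnj (iprod H x y) + of_real ((hnorm H y)\<^sup>2)"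
    using x y iprod_cnj[of x y] iprod_self[of "x \<oplus> y"] iprod_self[of x] iprod_self[of y]
    by (simp add: iprod_add iprod_add_left add_ac)
  then have "(hnorm H (x \<oplus> y))\<^sup>2 = (hnorm H x)\<^sup>2 + 2 * Re (iprod H x y) + (hnorm H y)\<^sup>2"
    unfolding complex_eq_iff by (simp del: of_real_power)
  also have "\<dots> \<le> (hnorm H x + hnorm H y)\<^sup>2"
    using cauchy_schwarz[OF x y] complex_Re_le_cmod[of "iprod H x y"] by (simp add: power2_sum)
  finally show ?thesis
    by (rule power2_le_imp_le) (use x y in \<open>simp add: hnorm_nonneg\<close>)
qed

end

sublocale hilbert_space \<subseteq> normed_module H "hnorm H"
  by unfold_locales (auto intro: hnorm_nonneg hnorm_definite hnorm_triangle hnorm_smult)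

context hilbert_space
begin

lemma iprod_minus:
  assumes "x \<in> carrier H" "y \<in> carrier H" "z \<in> carrier H"
  shows "iprod H x (y \<ominus> z) = iprod H x y - iprod H x z"
  using assms by (simp add: minus_eq iprod_add uminus_eq_smult iprod_smult)

lemma iprod_zero: "x \<in> carrier H \<Longrightarrow> iprod H x \<zero> = 0"
  using iprod_smult[of x \<zero> 0] by simp

lemma iprod_tendsto:
  assumes u: "norm_tendsto H (hnorm H) u x" "\<And>k. u k \<in> carrier H" "x \<in> carrier H"
    and y: "y \<in> carrier H"
  shows "(\<lambda>k. iprod H y (u k)) \<longlonglongrightarrow> iprod H y x"
proof (rule LIM_zero_cancel, rule tendsto_0_le[where K = "hnorm H y"])
  show "(\<lambda>k. hnorm H (u k \<ominus> x)) \<longlonglongrightarrow> 0" using u(1) by (simp add: norm_tendsto_def)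
  show "\<forall>\<^sub>F k in sequentially.
      norm (iprod H y (u k) - iprod H y x) \<le> norm (hnorm H (u k \<ominus> x)) * hnorm H y"
    using cauchy_schwarz[OF y, of "u k \<ominus> x" for k] u y
    by (intro always_eventually allI) (simp add: hnorm_nonneg iprod_minus mult.commute)
qed

text \<open>The vectors orthogonal to \<open>x\<close> form a closed submodule. It contains
  \<open>S\<close>, hence every vector, in particular \<open>x\<close> itself.\<close>

lemma total_orthogonal_imp_zero:
  assumes S: "total H (hnorm H) S" and x: "x \<in> carrier H" and orth: "\<And>s. s \<in> S \<Longrightarrow> iprod H s x = 0"
  shows "x = \<zero>"
proof -
  have "{z \<in> carrier H. iprod H x z = 0} = carrier H"
  proof (rule total_closed_submodule[OF S], rule closed_submoduleI)
    fix u z assume "\<And>k. u k \<in> {z \<in> carrier H. iprod H x z = 0}"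
      and z: "norm_tendsto H (hnorm H) u z" "z \<in> carrier H"
    then have "(\<lambda>k. 0) \<longlonglongrightarrow> iprod H x z"
      using iprod_tendsto[OF z(1) _ z(2) x] by simp
    then show "z \<in> {z \<in> carrier H. iprod H x z = 0}"
      using z(2) LIMSEQ_unique[OF tendsto_const[of 0]] by simp
  next
    show "S \<subseteq> {z \<in> carrier H. iprod H x z = 0}"
      using S orth x iprod_cnj[of _ x] by (auto simp: total_def)
  qed (use x in \<open>auto simp: iprod_zero iprod_add iprod_smult\<close>)
  then show ?thesis using x iprod_definite by blast
qed

end

section \<open>Unitaries from equal Gram matrices\<close>

text \<open>
  The graph of the unitary that sends one family to another one with the same Gram matrix. Defining
  it by duality avoids linear spans: it is a closed relation from the outset.
\<close>

definition gram_rel ::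
  "'h hilbert \<Rightarrow> 'k hilbert \<Rightarrow> ('i \<Rightarrow> 'h) \<Rightarrow> ('i \<Rightarrow> 'k) \<Rightarrow> 'i set \<Rightarrow> 'h \<Rightarrow> 'k \<Rightarrow> bool" where
  "gram_rel H K e f I x y \<longleftrightarrow> x \<in> carrier H \<and> y \<in> carrier K \<and>
     (\<forall>i\<in>I. iprod H (e i) x = iprod K (f i) y)"

lemma gram_rel_commute: "gram_rel H K e f I x y \<longleftrightarrow> gram_rel K H f e I y x"
  by (auto simp: gram_rel_def)

context
  fixes H :: "'h hilbert" and K :: "'k hilbert" and e :: "'i \<Rightarrow> 'h" and f :: "'i \<Rightarrow> 'k" and I :: "'i set"
  assumes H: "hilbert_space H" and K: "hilbert_space K"
    and e: "total H (hnorm H) (e ` I)" and f: "total K (hnorm K) (f ` I)"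
    and gram: "\<forall>i\<in>I. \<forall>j\<in>I. iprod H (e i) (e j) = iprod K (f i) (f j)"
begin

interpretation H: hilbert_space H by (rule H)
interpretation K: hilbert_space K by (rule K)

lemma gram_left_closed: "i \<in> I \<Longrightarrow> e i \<in> carrier H" using e by (auto simp: total_def)
lemma gram_right_closed: "i \<in> I \<Longrightarrow> f i \<in> carrier K" using f by (auto simp: total_def)

lemma gram_rel_add:
  assumes "gram_rel H K e f I x y" "gram_rel H K e f I x' y'"
  shows "gram_rel H K e f I (x \<oplus>\<^bsub>H\<^esub> x') (y \<oplus>\<^bsub>K\<^esub> y')"
  using assms gram_left_closed gram_right_closed by (simp add: gram_rel_def H.iprod_add K.iprod_add)

lemma gram_rel_smult:
  assumes "gram_rel H K e f I x y"
  shows "gram_rel H K e f I (c \<odot>\<^bsub>H\<^esub> x) (c \<odot>\<^bsub>K\<^esub> y)"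
  using assms gram_left_closed gram_right_closed by (simp add: gram_rel_def H.iprod_smult K.iprod_smult)

lemma gram_rel_minus:
  assumes "gram_rel H K e f I x y" "gram_rel H K e f I x' y'"
  shows "gram_rel H K e f I (x \<ominus>\<^bsub>H\<^esub> x') (y \<ominus>\<^bsub>K\<^esub> y')"
  using assms gram_left_closed gram_right_closed by (simp add: gram_rel_def H.iprod_minus K.iprod_minus)

lemma gram_rel_unique:
  assumes "gram_rel H K e f I x y" "gram_rel H K e f I x y'"
  shows "y = y'"
proof -
  have "y \<in> carrier K" "y' \<in> carrier K" using assms by (auto simp: gram_rel_def)
  moreover have "y \<ominus>\<^bsub>K\<^esub> y' = \<zero>\<^bsub>K\<^esub>"
    using assms gram_right_closed
    by (intro K.total_orthogonal_imp_zero[OF f]) (auto simp: gram_rel_def K.iprod_minus)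
  ultimately show ?thesis by (simp add: K.minus_eq_zero_iff)
qed

text \<open>The second conjunct strengthens the claim: inner products with every related pair are
  preserved, not only those with the family. Closedness rests on it, as it makes the partners of a
  Cauchy sequence a Cauchy sequence.\<close>

lemma gram_rel_total:
  assumes "x' \<in> carrier H"
  shows "\<exists>y'. gram_rel H K e f I x' y' \<and>
    (\<forall>x y. gram_rel H K e f I x y \<longrightarrow> iprod H x x' = iprod K y y')"
proof -
  let ?G = "gram_rel H K e f I"
  define P where "P x' y' \<longleftrightarrow> ?G x' y' \<and> (\<forall>x y. ?G x y \<longrightarrow> iprod H x x' = iprod K y y')" for x' y'
  have P_carrier: "x \<in> carrier H" "y \<in> carrier K" if "P x y" for x y
    using that by (auto simp: P_def gram_rel_def)
  have "{x'. \<exists>y'. P x' y'} = carrier H"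
  proof (rule total_closed_submodule[OF e], rule H.closed_submoduleI)
    show "{x'. \<exists>y'. P x' y'} \<subseteq> carrier H" using P_carrier by auto
    have "P \<zero>\<^bsub>H\<^esub> \<zero>\<^bsub>K\<^esub>"
      using gram_left_closed gram_right_closed by (auto simp: P_def gram_rel_def H.iprod_zero K.iprod_zero)
    then show "\<zero>\<^bsub>H\<^esub> \<in> {x'. \<exists>y'. P x' y'}" by blast
  next
    fix x1 x2 assume "x1 \<in> {x'. \<exists>y'. P x' y'}" "x2 \<in> {x'. \<exists>y'. P x' y'}"
    then obtain y1 y2 where "P x1 y1" "P x2 y2" by blast
    then have G: "?G x1 y1" "?G x2 y2"
      and Q: "\<And>x y. ?G x y \<Longrightarrow> iprod H x x1 = iprod K y y1" "\<And>x y. ?G x y \<Longrightarrow> iprod H x x2 = iprod K y y2"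
      by (auto simp: P_def)
    have "iprod H x (x1 \<oplus>\<^bsub>H\<^esub> x2) = iprod K y (y1 \<oplus>\<^bsub>K\<^esub> y2)" if "?G x y" for x y
      using Q[OF that] that G by (simp add: gram_rel_def H.iprod_add K.iprod_add)
    then have "P (x1 \<oplus>\<^bsub>H\<^esub> x2) (y1 \<oplus>\<^bsub>K\<^esub> y2)"
      using gram_rel_add[OF G] by (simp add: P_def)
    then show "x1 \<oplus>\<^bsub>H\<^esub> x2 \<in> {x'. \<exists>y'. P x' y'}" by blast
  next
    fix c x1 assume "x1 \<in> {x'. \<exists>y'. P x' y'}"
    then obtain y1 where "P x1 y1" by blast
    then have G: "?G x1 y1" and Q: "\<And>x y. ?G x y \<Longrightarrow> iprod H x x1 = iprod K y y1"
      by (auto simp: P_def)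
    have "iprod H x (c \<odot>\<^bsub>H\<^esub> x1) = iprod K y (c \<odot>\<^bsub>K\<^esub> y1)" if "?G x y" for x y
      using Q[OF that] that G by (simp add: gram_rel_def H.iprod_smult K.iprod_smult)
    then have "P (c \<odot>\<^bsub>H\<^esub> x1) (c \<odot>\<^bsub>K\<^esub> y1)"
      using gram_rel_smult[OF G] by (simp add: P_def)
    then show "c \<odot>\<^bsub>H\<^esub> x1 \<in> {x'. \<exists>y'. P x' y'}" by blast
  next
    show "e ` I \<subseteq> {x'. \<exists>y'. P x' y'}"
    proof clarify
      fix j assume j: "j \<in> I"
      \<comment> \<open>For members of the family the second conjunct is the definition of
        \<open>gram_rel\<close>, conjugated.\<close>
      have "iprod H x (e j) = iprod K y (f j)" if "?G x y" for x y
        using that j H.iprod_cnj[of "e j" x] K.iprod_cnj[of "f j" y] gram_left_closed[OF j] gram_right_closed[OF j]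
        by (simp add: gram_rel_def)
      then have "P (e j) (f j)"
        using j gram gram_left_closed gram_right_closed by (auto simp: P_def gram_rel_def)
      then show "\<exists>y'. P (e j) y'" by blast
    qed
  next
    fix u x' assume "\<And>k. u k \<in> {x'. \<exists>y'. P x' y'}" and u: "norm_tendsto H (hnorm H) u x'"
      and x': "x' \<in> carrier H"
    then have "\<forall>k. \<exists>y. P (u k) y" by blast
    then obtain v where v: "\<And>k. P (u k) (v k)" by metis
    note uv = P_carrier[OF v]
    \<comment> \<open>Differences of related pairs are again related. Testing such a difference
      against the pairs number \<open>k\<close> and \<open>l\<close> and subtracting gives its
      square norm.\<close>
    have "iprod H (u k \<ominus>\<^bsub>H\<^esub> u l) (u k \<ominus>\<^bsub>H\<^esub> u l) = iprod K (v k \<ominus>\<^bsub>K\<^esub> v l) (v k \<ominus>\<^bsub>K\<^esub> v l)" for k l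
    proof -
      have G: "?G (u k \<ominus>\<^bsub>H\<^esub> u l) (v k \<ominus>\<^bsub>K\<^esub> v l)"
        using v by (auto simp: P_def gram_rel_minus)
      have "iprod H (u k \<ominus>\<^bsub>H\<^esub> u l) (u m) = iprod K (v k \<ominus>\<^bsub>K\<^esub> v l) (v m)" for m
        using v[of m] G by (auto simp: P_def)
      then show ?thesis
        using uv by (simp add: H.iprod_minus K.iprod_minus)
    qed
    then have norm_eq: "hnorm K (v k \<ominus>\<^bsub>K\<^esub> v l) = hnorm H (u k \<ominus>\<^bsub>H\<^esub> u l)" for k l
      by (simp add: hnorm_def)
    have "\<exists>y'\<in>carrier K. norm_tendsto K (hnorm K) v y'"
      using K.hilbert_complete[unfolded norm_complete_def, rule_format, of v]
        H.norm_tendsto_cauchy[OF u uv(1) x'] uv(2) by (simp add: norm_eq)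
    then obtain y' where y': "y' \<in> carrier K" "norm_tendsto K (hnorm K) v y'" by blast
    have lim: "iprod H x x' = iprod K y y'"
      if "x \<in> carrier H" "y \<in> carrier K" "\<And>k. iprod H x (u k) = iprod K y (v k)" for x y
      using LIMSEQ_unique[OF H.iprod_tendsto[OF u uv(1) x' that(1)]]
        K.iprod_tendsto[OF y'(2) uv(2) y'(1) that(2)] that(3) by simp
    have "?G x' y'"
      unfolding gram_rel_def
      using x' y'(1) gram_left_closed gram_right_closed v by (auto intro!: lim simp: P_def gram_rel_def)
    moreover have "iprod H x x' = iprod K y y'" if "?G x y" for x y
      using that v by (intro lim) (auto simp: P_def gram_rel_def)
    ultimately have "P x' y'" by (simp add: P_def)
    then show "x' \<in> {x'. \<exists>y'. P x' y'}" by blast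
  qed
  then show ?thesis using assms unfolding P_def by blast
qed

end

text \<open>Exchanging the two families reverses \<open>gram_rel\<close>. Totality in the reverse
  direction therefore gives surjectivity of \<open>U\<close>, and uniqueness in that direction gives
  injectivity.\<close>

lemma unitary_of_gram:
  assumes H: "hilbert_space H" and K: "hilbert_space K"
    and e: "total H (hnorm H) (e ` I)" and f: "total K (hnorm K) (f ` I)"
    and gram: "\<forall>i\<in>I. \<forall>j\<in>I. iprod H (e i) (e j) = iprod K (f i) (f j)"
  obtains U where "unitary H K U" "\<And>i. i \<in> I \<Longrightarrow> U (e i) = f i"
proof -
  note hyps = H K e f gram
  have gram': "\<forall>i\<in>I. \<forall>j\<in>I. iprod K (f i) (f j) = iprod H (e i) (e j)"
    using gram by simp
  note hyps' = K H f e gram'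
  interpret H: hilbert_space H by (rule H)
  interpret K: hilbert_space K by (rule K)
  let ?G = "gram_rel H K e f I"
  obtain U where U: "\<And>x. x \<in> carrier H \<Longrightarrow> ?G x (U x)"
    and iprod_U: "\<And>x' x y. \<lbrakk>x' \<in> carrier H; ?G x y\<rbrakk> \<Longrightarrow> iprod H x x' = iprod K y (U x')"
    using gram_rel_total[OF hyps] by metis
  have U_eq: "U x = y" if "?G x y" for x y
  proof -
    have "x \<in> carrier H" using that by (simp add: gram_rel_def)
    then show ?thesis using gram_rel_unique[OF hyps U that] by simp
  qed
  have U_closed: "U x \<in> carrier K" if "x \<in> carrier H" for x
    using U[OF that] by (simp add: gram_rel_def)
  have "linear_on H K U"
    unfolding linear_on_def
    using U U_closed gram_rel_add[OF hyps] gram_rel_smult[OF hyps] by (auto intro!: U_eq)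
  moreover have "bij_betw U (carrier H) (carrier K)"
    unfolding bij_betw_def
  proof
    show "inj_on U (carrier H)"
    proof (rule inj_onI)
      fix x x' assume x: "x \<in> carrier H" "x' \<in> carrier H" "U x = U x'"
      then have "gram_rel K H f e I (U x) x" "gram_rel K H f e I (U x) x'"
        using U[of x] U[of x'] gram_rel_commute[of H K e f I] by auto
      then show "x = x'" by (rule gram_rel_unique[OF hyps'])
    qed
    have "y \<in> U ` carrier H" if "y \<in> carrier K" for y
    proof -
      from gram_rel_total[OF hyps' that] obtain x where "gram_rel K H f e I y x" by blast
      then have "?G x y" by (subst gram_rel_commute)
      then have "x \<in> carrier H" "U x = y" using U_eq by (simp_all add: gram_rel_def)
      then show ?thesis by blast
    qed
    then show "U ` carrier H = carrier K" using U_closed by blast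
  qed
  ultimately have "unitary H K U"
    unfolding unitary_def using iprod_U[OF _ U, symmetric] by blast
  moreover have "U (e i) = f i" if "i \<in> I" for i
    using that e f gram by (intro U_eq) (auto simp: gram_rel_def total_def)
  ultimately show ?thesis by (rule that)
qed

section \<open>C*-algebras and automatic continuity of representations\<close>

sublocale unital_cstar_algebra \<subseteq> normed_module A "cnorm A"
  by unfold_locales (auto intro: cnorm_nonneg cnorm_definite cnorm_triangle cnorm_smult)

context unital_cstar_algebra
begin

lemma star_uminus: "x \<in> carrier A \<Longrightarrow> star A (\<ominus> x) = \<ominus> (star A x)"
  by (simp add: uminus_eq_smult star_smult star_closed)

lemma star_minus: "\<lbrakk>x \<in> carrier A; y \<in> carrier A\<rbrakk> \<Longrightarrow> star A (x \<ominus> y) = star A x \<ominus> star A y"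
  by (simp add: minus_eq star_add star_uminus)

lemma star_zero: "star A \<zero> = \<zero>"
  using star_smult[of \<zero> 0] star_closed[of \<zero>] by simp

lemma star_one: "star A \<one> = \<one>"
  using star_mult[of "star A \<one>" \<one>] star_star[of \<one>] star_closed[of \<one>] by simp

text \<open>By the C*-identity the square of \<open>cnorm A x\<close> is at most
  \<open>cnorm A (star A x) * cnorm A x\<close>. Cancelling one factor gives one inequality, and
  \<open>star A x\<close> in place of \<open>x\<close> gives the other.\<close>

lemma cnorm_star_eq:
  assumes "x \<in> carrier A"
  shows "cnorm A (star A x) = cnorm A x"
proof -
  have le: "cnorm A x \<le> cnorm A (star A x)" if x: "x \<in> carrier A" for x
  proof (cases "cnorm A x = 0")
    case False
    have "cnorm A x * cnorm A x \<le> cnorm A (star A x) * cnorm A x"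
      using cnorm_mult[of "star A x" x] cnorm_star[of x] x star_closed by (simp add: power2_eq_square)
    then show ?thesis
      using False cnorm_nonneg[OF x] by simp
  qed (use x in \<open>simp add: cnorm_nonneg star_closed\<close>)
  show ?thesis
    using le[OF assms] le[OF star_closed[OF assms]] star_star[OF assms] by simp
qed

lemma square_minus_square:
  assumes "x \<in> carrier A" "y \<in> carrier A"
  shows "x \<otimes> x \<ominus> y \<otimes> y = x \<otimes> (x \<ominus> y) \<oplus> (x \<ominus> y) \<otimes> y"
  using assms by (simp add: minus_eq r_distr l_distr r_minus l_minus a_assoc r_neg1)

lemma cnorm_square_minus_square:
  assumes x: "x \<in> carrier A" and y: "y \<in> carrier A"
  shows "cnorm A (x \<otimes> x \<ominus> y \<otimes> y) \<le> (cnorm A x + cnorm A y) * cnorm A (x \<ominus> y)"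
proof -
  have "cnorm A (x \<otimes> x \<ominus> y \<otimes> y) \<le> cnorm A (x \<otimes> (x \<ominus> y)) + cnorm A ((x \<ominus> y) \<otimes> y)"
    unfolding square_minus_square[OF x y] using x y by (intro cnorm_triangle) auto
  also have "\<dots> \<le> cnorm A x * cnorm A (x \<ominus> y) + cnorm A (x \<ominus> y) * cnorm A y"
    using x y by (intro add_mono cnorm_mult) auto
  finally show ?thesis by (simp add: algebra_simps)
qed

text \<open>The fixed points of \<open>b = (c + b\<^sup>2) / 2\<close> are the solutions of \<open>(1 - b)\<^sup>2 = 1 - c\<close>.\<close>

lemma exists_sqrt_one_minus:
  assumes c: "c \<in> carrier A" "star A c = c" "cnorm A c \<le> 1 / 4"
  obtains b where "b \<in> carrier A" "star A b = b" "(\<one> \<ominus> b) \<otimes> (\<one> \<ominus> b) = \<one> \<ominus> c"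
proof -
  \<comment> \<open>Since \<open>c\<close> has norm at most 1/4, \<open>F\<close> maps the ball of
    radius 1/2 into itself, as (1/4 + 1/4) / 2 <= 1/2, and it is Lipschitz there with constant (1/2
    + 1/2) / 2 = 1/2.\<close>
  define F where "F x = (1 / 2) \<odot> (c \<oplus> x \<otimes> x)" for x
  define u where "u = rec_nat \<zero> (\<lambda>_. F)"
  have u_simps: "u 0 = \<zero>" "u (Suc k) = F (u k)" for k
    by (simp_all add: u_def)
  have F_closed: "F x \<in> carrier A" if "x \<in> carrier A" for x
    using that c by (simp add: F_def)
  have F_minus: "cnorm A (F x \<ominus> F y) \<le> (cnorm A x + cnorm A y) / 2 * cnorm A (x \<ominus> y)"
    if "x \<in> carrier A" "y \<in> carrier A" for x y
  proof -
    have "F x \<ominus> F y = (1 / 2) \<odot> (x \<otimes> x \<ominus> y \<otimes> y)"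
      using that c
      by (simp add: F_def minus_eq smult_r_distr smult_r_minus minus_add a_ac r_neg1 r_neg2)
    then show ?thesis
      using cnorm_square_minus_square[OF that] that by (simp add: nrm_smult)
  qed
  have u: "u k \<in> carrier A \<and> star A (u k) = u k \<and> cnorm A (u k) \<le> 1 / 2" for k
  proof (induction k)
    case (Suc k)
    have "cnorm A (F (u k)) \<le> 1 / 2 * (cnorm A c + cnorm A (u k) * cnorm A (u k))"
      using Suc c cnorm_triangle[of c "u k \<otimes> u k"] cnorm_mult[of "u k" "u k"]
      by (simp add: F_def cnorm_smult)
    also have "\<dots> \<le> 1 / 2 * (1 / 4 + 1 / 2 * (1 / 2))"
      using Suc c by (intro mult_left_mono add_mono mult_mono) (auto simp: cnorm_nonneg)
    finally show ?case
      using Suc c by (simp add: u_simps F_closed) (simp add: F_def star_smult star_add star_mult)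
  qed (simp add: u_simps star_zero)
  have step: "cnorm A (u (Suc k) \<ominus> u k) \<le> 1 * (1 / 2) ^ k" for k
  proof (induction k)
    case 0
    show ?case using u[of 1] by (simp add: u_simps minus_eq uminus_zero)
  next
    case (Suc k)
    have "cnorm A (F (u (Suc k)) \<ominus> F (u k))
        \<le> (cnorm A (u (Suc k)) + cnorm A (u k)) / 2 * cnorm A (u (Suc k) \<ominus> u k)"
      using u by (intro F_minus) auto
    also have "\<dots> \<le> 1 / 2 * (1 * (1 / 2) ^ k)"
      using u[of k] u[of "Suc k"] Suc by (intro mult_mono) (auto simp: cnorm_nonneg)
    finally show ?case by (simp add: u_simps(2)[of "Suc k"] u_simps(2)[of k])
  qed
  obtain b where b: "b \<in> carrier A" "norm_tendsto A (cnorm A) u b"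
    by (rule geometric_limit[OF cstar_complete _ step]) (use u in auto)
  have u_closed: "u k \<in> carrier A" for k using u by blast
  \<comment> \<open>The star operation is isometric and fixes every \<open>u k\<close>, so
    \<open>star A b\<close> is a limit of the same sequence.\<close>
  have "norm_tendsto A (cnorm A) u (star A b)"
    using b(2) cnorm_star_eq[of "u k \<ominus> b" for k] u b(1)
    by (simp add: norm_tendsto_def star_minus)
  then have star_b: "star A b = b"
    using norm_tendsto_unique[OF _ b(2) u_closed] b(1) star_closed by blast
  \<comment> \<open>Continuity of \<open>F\<close> at \<open>b\<close>. The constant is the one from
    \<open>F_minus\<close>, with 1/2 for the norm of \<open>u k\<close> and the norm of
    \<open>b\<close> left as it is.\<close>
  have "norm_tendsto A (cnorm A) (\<lambda>k. u (Suc k)) (F b)"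
    unfolding norm_tendsto_def
  proof (rule tendsto_0_le[where K = "(1 / 2 + cnorm A b) / 2"])
    show "(\<lambda>k. cnorm A (u k \<ominus> b)) \<longlonglongrightarrow> 0" using b(2) by (simp add: norm_tendsto_def)
    have "cnorm A (u (Suc k) \<ominus> F b) \<le> cnorm A (u k \<ominus> b) * ((1 / 2 + cnorm A b) / 2)" for k
    proof -
      have "cnorm A (u (Suc k) \<ominus> F b) \<le> (cnorm A (u k) + cnorm A b) / 2 * cnorm A (u k \<ominus> b)"
        unfolding u_simps by (rule F_minus) (use u b in auto)
      also have "\<dots> \<le> (1 / 2 + cnorm A b) / 2 * cnorm A (u k \<ominus> b)"
        using u[of k] b(1) by (intro mult_right_mono divide_right_mono) (auto simp: cnorm_nonneg)
      finally show ?thesis by (simp add: mult.commute)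
    qed
    then show "\<forall>\<^sub>F k in sequentially. norm (cnorm A (u (Suc k) \<ominus> F b))
        \<le> norm (cnorm A (u k \<ominus> b)) * ((1 / 2 + cnorm A b) / 2)"
      using u_closed b(1) F_closed by (intro always_eventually allI) (simp add: cnorm_nonneg)
  qed
  moreover have "norm_tendsto A (cnorm A) (\<lambda>k. u (Suc k)) b"
    using LIMSEQ_Suc[OF b(2)[unfolded norm_tendsto_def]] by (simp add: norm_tendsto_def)
  ultimately have "F b = b"
    using norm_tendsto_unique[of "\<lambda>k. u (Suc k)" "F b" b] u_closed b(1) F_closed by blast
  then have "b \<oplus> b = F b \<oplus> F b" by simp
  also have "\<dots> = c \<oplus> b \<otimes> b"
    using c b(1) smult_add_left[of "c \<oplus> b \<otimes> b" "1 / 2" "1 / 2"] by (simp add: F_def)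
  finally have bb: "b \<oplus> b = c \<oplus> b \<otimes> b" .
  have "(\<one> \<ominus> b) \<otimes> (\<one> \<ominus> b) = \<one> \<ominus> (b \<oplus> b) \<oplus> b \<otimes> b"
    using b(1) by (simp add: minus_eq l_distr r_distr l_minus r_minus minus_add a_ac)
  also have "\<dots> = \<one> \<ominus> c"
    unfolding bb using b(1) c by (simp add: minus_eq minus_add a_assoc l_neg)
  finally show ?thesis using that b(1) star_b by blast
qed

end

section \<open>Representations are norm continuous\<close>

lemma unital_star_repD:
  assumes "unital_star_rep A (H, \<pi>)"
  shows "hilbert_space H"
    and "a \<in> carrier A \<Longrightarrow> linear_on H H (\<pi> a)"
    and "\<lbrakk>a \<in> carrier A; b \<in> carrier A; x \<in> carrier H\<rbrakk> \<Longrightarrow> \<pi> (a \<oplus>\<^bsub>A\<^esub> b) x = \<pi> a x \<oplus>\<^bsub>H\<^esub> \<pi> b x"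
    and "\<lbrakk>a \<in> carrier A; x \<in> carrier H\<rbrakk> \<Longrightarrow> \<pi> (c \<odot>\<^bsub>A\<^esub> a) x = c \<odot>\<^bsub>H\<^esub> \<pi> a x"
    and "\<lbrakk>a \<in> carrier A; b \<in> carrier A; x \<in> carrier H\<rbrakk> \<Longrightarrow> \<pi> (a \<otimes>\<^bsub>A\<^esub> b) x = \<pi> a (\<pi> b x)"
    and "x \<in> carrier H \<Longrightarrow> \<pi> \<one>\<^bsub>A\<^esub> x = x"
    and "\<lbrakk>a \<in> carrier A; x \<in> carrier H; y \<in> carrier H\<rbrakk> \<Longrightarrow>
      iprod H (\<pi> a x) y = iprod H x (\<pi> (star A a) y)"
  using assms by (auto simp: unital_star_rep_def bounded_operator_def is_adjoint_def)

text \<open>If \<open>a\<close> has norm at most 1/2, then \<open>c\<close>, the product of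
  \<open>star A a\<close> and \<open>a\<close>, has norm at most 1/4, so one minus \<open>c\<close>
  is the square of a self-adjoint \<open>d\<close>. The square norm of \<open>x\<close> minus that
  of \<open>\<pi> a x\<close> is then the square norm of \<open>\<pi> d x\<close>, hence
  nonnegative. Scaling an arbitrary \<open>a\<close> to norm 1/2 accounts for the factor 2.\<close>

lemma unital_star_rep_bounded:
  assumes A: "unital_cstar_algebra A" and rep: "unital_star_rep A (H, \<pi>)"
    and a: "a \<in> carrier A" and x: "x \<in> carrier H"
  shows "hnorm H (\<pi> a x) \<le> 2 * cnorm A a * hnorm H x"
proof -
  interpret A: unital_cstar_algebra A by fact
  note rep = unital_star_repD[OF rep]
  interpret H: hilbert_space H by (rule rep(1))
  have \<pi>_closed: "\<pi> a x \<in> carrier H" if "a \<in> carrier A" "x \<in> carrier H" for a x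
    using rep(2)[OF that(1)] that(2) by auto
  have small: "hnorm H (\<pi> a x) \<le> hnorm H x" if a: "a \<in> carrier A" "cnorm A a \<le> 1 / 2" for a
  proof -
    define c where "c = star A a \<otimes>\<^bsub>A\<^esub> a"
    have c: "c \<in> carrier A" "star A c = c"
      using a by (simp_all add: c_def A.star_closed A.star_mult A.star_star)
    have "cnorm A c \<le> 1 / 4"
      using power_mono[OF a(2) A.cnorm_nonneg[OF a(1)], of 2] a(1)
      by (simp add: c_def A.cnorm_star power2_eq_square)
    then obtain b where b: "b \<in> carrier A" "star A b = b"
      and sqrt: "(\<one>\<^bsub>A\<^esub> \<ominus>\<^bsub>A\<^esub> b) \<otimes>\<^bsub>A\<^esub> (\<one>\<^bsub>A\<^esub> \<ominus>\<^bsub>A\<^esub> b) = \<one>\<^bsub>A\<^esub> \<ominus>\<^bsub>A\<^esub> c"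
      using A.exists_sqrt_one_minus[OF c] by metis
    let ?d = "\<one>\<^bsub>A\<^esub> \<ominus>\<^bsub>A\<^esub> b"
    have d: "?d \<in> carrier A" "star A ?d = ?d"
      using b by (simp_all add: A.star_minus A.star_one)
    have "\<pi> (\<one>\<^bsub>A\<^esub> \<ominus>\<^bsub>A\<^esub> c) x = x \<ominus>\<^bsub>H\<^esub> \<pi> c x"
      using c(1) x
      by (simp add: A.minus_eq A.uminus_eq_smult rep(3,4,6) H.minus_eq H.uminus_eq_smult \<pi>_closed)
    moreover have "iprod H x (\<pi> (\<one>\<^bsub>A\<^esub> \<ominus>\<^bsub>A\<^esub> c) x) = iprod H (\<pi> ?d x) (\<pi> ?d x)"
      using d x rep(5)[of ?d ?d x] rep(7)[of ?d x "\<pi> ?d x"] sqrt \<pi>_closed by simp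
    moreover have "iprod H x (\<pi> c x) = iprod H (\<pi> a x) (\<pi> a x)"
      using a x rep(5)[of "star A a" a x] rep(7)[of a x "\<pi> a x"] A.star_closed \<pi>_closed
      by (simp add: c_def)
    ultimately have "iprod H x x - iprod H (\<pi> a x) (\<pi> a x) = iprod H (\<pi> ?d x) (\<pi> ?d x)"
      using x c(1) by (simp add: H.iprod_minus \<pi>_closed)
    moreover have "0 \<le> Re (iprod H (\<pi> ?d x) (\<pi> ?d x))"
      using d x by (intro H.iprod_nonneg \<pi>_closed)
    ultimately have "Re (iprod H (\<pi> a x) (\<pi> a x)) \<le> Re (iprod H x x)"
      by (metis diff_ge_0_iff_ge minus_complex.simps(1))
    then show ?thesis by (simp add: hnorm_def)
  qed
  show ?thesis
  proof (cases "cnorm A a = 0")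
    case True
    then have "a = \<zero>\<^bsub>A\<^esub>" using a A.cnorm_definite by blast
    then have "\<pi> a x = \<zero>\<^bsub>H\<^esub>"
      using rep(4)[of "\<zero>\<^bsub>A\<^esub>" x 0] x \<pi>_closed by simp
    then show ?thesis using True by simp
  next
    case False
    then have pos: "cnorm A a > 0" using A.cnorm_nonneg[OF a] by simp
    define r where "r = 1 / (2 * cnorm A a)"
    have r: "r > 0" using pos by (simp add: r_def)
    have "hnorm H (\<pi> (complex_of_real r \<odot>\<^bsub>A\<^esub> a) x) \<le> hnorm H x"
    proof (rule small)
      show "cnorm A (complex_of_real r \<odot>\<^bsub>A\<^esub> a) \<le> 1 / 2"
        using r pos a by (simp add: A.cnorm_smult) (simp add: r_def)
    qed (use a in auto)
    then have "r * hnorm H (\<pi> a x) \<le> hnorm H x"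
      using r a x by (simp add: rep(4) H.hnorm_smult \<pi>_closed)
    then show ?thesis using pos by (simp add: r_def field_simps)
  qed
qed

section \<open>Cuntz families and tensor products\<close>

lemma pair_index_range:
  fixes i j N M :: nat
  assumes "i \<in> {1..N}" "j \<in> {1..M}"
  shows "M * (i - 1) + j \<in> {1..N * M}"
proof -
  have "M * (i - 1) + j \<le> M * (i - 1) + M * 1" using assms by simp
  also have "\<dots> = M * i" using assms by (cases i) auto
  also have "\<dots> \<le> N * M" using assms by simp
  finally show ?thesis using assms by simp
qed

text \<open>Division with remainder inverts the pairing once the indices, which start at 1, are
  shifted down by 1.\<close>

lemma pair_index_div_mod:
  fixes i j M :: nat
  assumes "1 \<le> i" "j \<in> {1..M}"
  shows "(M * (i - 1) + j - 1) div M + 1 = i" "(M * (i - 1) + j - 1) mod M + 1 = j"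
proof -
  obtain i' j' where "i = Suc i'" "j = Suc j'" "j' < M"
    using assms by (cases i; cases j) auto
  then show "(M * (i - 1) + j - 1) div M + 1 = i" "(M * (i - 1) + j - 1) mod M + 1 = j"
    by simp_all
qed

lemma pair_index_surj:
  fixes k N M :: nat
  assumes "k \<in> {1..N * M}"
  shows "(k - 1) div M + 1 \<in> {1..N}" "(k - 1) mod M + 1 \<in> {1..M}"
    and "M * ((k - 1) div M + 1 - 1) + ((k - 1) mod M + 1) = k"
proof -
  have "k - 1 < N * M" using assms by auto
  then have "(k - 1) div M < N" by (simp add: less_mult_imp_div_less)
  moreover have "M > 0" using assms by (cases M) auto
  ultimately show "(k - 1) div M + 1 \<in> {1..N}" "(k - 1) mod M + 1 \<in> {1..M}"
    by (auto simp: Suc_le_eq)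
  show "M * ((k - 1) div M + 1 - 1) + ((k - 1) mod M + 1) = k"
    using assms mult_div_mod_eq[of M "k - 1"] by simp
qed

text \<open>The range consists of \<open>N\<close> consecutive blocks of length \<open>M\<close>;
  the induction on \<open>N\<close> splits off the last block.\<close>

lemma (in abelian_monoid) finsum_pair_index:
  fixes N M :: nat
  assumes "g \<in> {1..N * M} \<rightarrow> carrier G"
  shows "(\<Oplus>\<^bsub>G\<^esub>k\<in>{1..N * M}. g k) = (\<Oplus>\<^bsub>G\<^esub>i\<in>{1..N}. \<Oplus>\<^bsub>G\<^esub>j\<in>{1..M}. g (M * (i - 1) + j))"
  using assms
proof (induction N)
  case (Suc N)
  have split: "{1..Suc N * M} = {1..N * M} \<union> (\<lambda>j. M * N + j) ` {1..M}"
  proof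
    show "{1..Suc N * M} \<subseteq> {1..N * M} \<union> (\<lambda>j. M * N + j) ` {1..M}"
    proof
      fix k assume k: "k \<in> {1..Suc N * M}"
      show "k \<in> {1..N * M} \<union> (\<lambda>j. M * N + j) ` {1..M}"
      proof (cases "k \<le> N * M")
        case False
        then have "k = M * N + (k - N * M)" "k - N * M \<in> {1..M}" using k by (auto simp: mult.commute)
        then show ?thesis by blast
      qed (use k in auto)
    qed
  qed (auto simp: mult.commute)
  have g: "g \<in> {1..N * M} \<rightarrow> carrier G" "g \<in> (\<lambda>j. M * N + j) ` {1..M} \<rightarrow> carrier G"
    using Suc.prems unfolding split by auto
  have inner: "(\<Oplus>\<^bsub>G\<^esub>j\<in>{1..M}. g (M * (i - 1) + j)) \<in> carrier G" if "i \<in> {1..Suc N}" for i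
    using Suc.prems pair_index_range[OF that] by (intro finsum_closed) auto
  have "(\<Oplus>\<^bsub>G\<^esub>k\<in>{1..Suc N * M}. g k)
      = (\<Oplus>\<^bsub>G\<^esub>k\<in>{1..N * M}. g k) \<oplus>\<^bsub>G\<^esub> (\<Oplus>\<^bsub>G\<^esub>k\<in>(\<lambda>j. M * N + j) ` {1..M}. g k)"
    unfolding split using g by (intro finsum_Un_disjoint) (auto simp: mult.commute)
  also have "(\<Oplus>\<^bsub>G\<^esub>k\<in>(\<lambda>j. M * N + j) ` {1..M}. g k) = (\<Oplus>\<^bsub>G\<^esub>j\<in>{1..M}. g (M * (Suc N - 1) + j))"
    using finsum_reindex[OF g(2)] by simp
  also have "(\<Oplus>\<^bsub>G\<^esub>k\<in>{1..N * M}. g k) = (\<Oplus>\<^bsub>G\<^esub>i\<in>{1..N}. \<Oplus>\<^bsub>G\<^esub>j\<in>{1..M}. g (M * (i - 1) + j))"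
    using g(1) by (rule Suc.IH)
  also have "\<dots> \<oplus>\<^bsub>G\<^esub> (\<Oplus>\<^bsub>G\<^esub>j\<in>{1..M}. g (M * (Suc N - 1) + j))
      = (\<Oplus>\<^bsub>G\<^esub>i\<in>{1..Suc N}. \<Oplus>\<^bsub>G\<^esub>j\<in>{1..M}. g (M * (i - 1) + j))"
  proof -
    have ins: "{1..Suc N} = insert (Suc N) {1..N}" by auto
    define h where "h i = (\<Oplus>\<^bsub>G\<^esub>j\<in>{1..M}. g (M * (i - 1) + j))" for i
    have "h \<in> {1..N} \<rightarrow> carrier G" "h (Suc N) \<in> carrier G"
      using inner inner[of "Suc N"] by (auto simp: h_def)
    then show ?thesis
      unfolding ins h_def[symmetric] by (subst finsum_insert) (simp_all add: a_comm)
  qed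
  finally show ?case .
qed simp

section \<open>Products of Cuntz families\<close>

lemma bilinear_on_zero:
  assumes "Module.module complex_ring U" "Module.module complex_ring V" "Module.module complex_ring W"
    and "bilinear_on U V W b"
  shows "x \<in> carrier U \<Longrightarrow> b x \<zero>\<^bsub>V\<^esub> = \<zero>\<^bsub>W\<^esub>" "y \<in> carrier V \<Longrightarrow> b \<zero>\<^bsub>U\<^esub> y = \<zero>\<^bsub>W\<^esub>"
  using assms linear_on_zero[of V W "b x"] linear_on_zero[of U W "\<lambda>x. b x y"]
  by (auto simp: bilinear_on_def)

lemma bilinear_on_closed:
  "\<lbrakk>bilinear_on U V W b; x \<in> carrier U; y \<in> carrier V\<rbrakk> \<Longrightarrow> b x y \<in> carrier W"
  unfolding bilinear_on_def by auto

text \<open>The family is indexed by a single number, decoded by quotient and remainder, because the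
  universal property of the algebra on \<open>N * M\<close> generators expects this form. The
  orthogonality relations hold factor by factor. The sum of the range projections splits by
  bilinearity into the sums for \<open>s\<close> and \<open>r\<close>.\<close>

lemma cuntz_family_tensor:
  assumes A: "unital_cstar_algebra A" and B: "unital_cstar_algebra B"
    and s: "cuntz_family N A s" and r: "cuntz_family M B r" and t: "cstar_tensor A B T t"
  shows "cuntz_family (N * M) T (\<lambda>k. t (s ((k - 1) div M + 1)) (r ((k - 1) mod M + 1)))"
    (is "cuntz_family _ _ ?u")
proof -
  interpret A: unital_cstar_algebra A by fact
  interpret B: unital_cstar_algebra B by fact
  interpret T: unital_cstar_algebra T using t by (simp add: cstar_tensor_def)
  note mods = A.module_axioms B.module_axioms T.module_axioms
  have bil: "bilinear_on A B T t" and t_one: "t \<one>\<^bsub>A\<^esub> \<one>\<^bsub>B\<^esub> = \<one>\<^bsub>T\<^esub>"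
    and t_mult: "\<And>a b a' b'. \<lbrakk>a \<in> carrier A; b \<in> carrier B; a' \<in> carrier A; b' \<in> carrier B\<rbrakk> \<Longrightarrow>
      t a b \<otimes>\<^bsub>T\<^esub> t a' b' = t (a \<otimes>\<^bsub>A\<^esub> a') (b \<otimes>\<^bsub>B\<^esub> b')"
    and t_star: "\<And>a b. \<lbrakk>a \<in> carrier A; b \<in> carrier B\<rbrakk> \<Longrightarrow> star T (t a b) = t (star A a) (star B b)"
    using t by (auto simp: cstar_tensor_def)
  have s_closed: "s i \<in> carrier A" if "i \<in> {1..N}" for i using s that by (auto simp: cuntz_family_def)
  have r_closed: "r j \<in> carrier B" if "j \<in> {1..M}" for j using r that by (auto simp: cuntz_family_def)
  have s_rel: "star A (s i) \<otimes>\<^bsub>A\<^esub> s i' = (if i = i' then \<one>\<^bsub>A\<^esub> else \<zero>\<^bsub>A\<^esub>)" if "i \<in> {1..N}" "i' \<in> {1..N}" for i i'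
    using s that by (auto simp: cuntz_family_def)
  have r_rel: "star B (r i) \<otimes>\<^bsub>B\<^esub> r i' = (if i = i' then \<one>\<^bsub>B\<^esub> else \<zero>\<^bsub>B\<^esub>)" if "i \<in> {1..M}" "i' \<in> {1..M}" for i i'
    using r that by (auto simp: cuntz_family_def)
  have u_closed: "?u k \<in> carrier T" if "k \<in> {1..N * M}" for k
    using pair_index_surj[OF that] s_closed r_closed bilinear_on_closed[OF bil] by blast
  have rel: "star T (?u k) \<otimes>\<^bsub>T\<^esub> ?u l = (if k = l then \<one>\<^bsub>T\<^esub> else \<zero>\<^bsub>T\<^esub>)"
    if k: "k \<in> {1..N * M}" and l: "l \<in> {1..N * M}" for k l
  proof -
    define i j i' j' where "i = (k - 1) div M + 1" and "j = (k - 1) mod M + 1"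
      and "i' = (l - 1) div M + 1" and "j' = (l - 1) mod M + 1"
    note ij = pair_index_surj[OF k, folded i_def j_def] pair_index_surj[OF l, folded i'_def j'_def]
    have "star T (?u k) \<otimes>\<^bsub>T\<^esub> ?u l = t (star A (s i) \<otimes>\<^bsub>A\<^esub> s i') (star B (r j) \<otimes>\<^bsub>B\<^esub> r j')"
      unfolding i_def[symmetric] j_def[symmetric] i'_def[symmetric] j'_def[symmetric]
      using ij s_closed r_closed by (simp add: t_star t_mult A.star_closed B.star_closed)
    \<comment> \<open>If one of the two indices differs, that factor is zero and so is the
      tensor.\<close>
    also have "\<dots> = (if i = i' \<and> j = j' then \<one>\<^bsub>T\<^esub> else \<zero>\<^bsub>T\<^esub>)"
      using ij by (simp add: s_rel r_rel t_one bilinear_on_zero[OF mods bil])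
    also have "i = i' \<and> j = j' \<longleftrightarrow> k = l"
      using ij(3,6) i_def j_def i'_def j'_def by metis
    finally show ?thesis .
  qed
  let ?p = "\<lambda>i. s i \<otimes>\<^bsub>A\<^esub> star A (s i)" and ?q = "\<lambda>j. r j \<otimes>\<^bsub>B\<^esub> star B (r j)"
  have p: "?p i \<in> carrier A" if "i \<in> {1..N}" for i using s_closed[OF that] A.star_closed by simp
  have q: "?q j \<in> carrier B" if "j \<in> {1..M}" for j using r_closed[OF that] B.star_closed by simp
  have p_sum: "(\<Oplus>\<^bsub>A\<^esub>i\<in>{1..N}. ?p i) = \<one>\<^bsub>A\<^esub>" and q_sum: "(\<Oplus>\<^bsub>B\<^esub>j\<in>{1..M}. ?q j) = \<one>\<^bsub>B\<^esub>"
    using s r by (auto simp: cuntz_family_def)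
  have u_pair: "?u (M * (i - 1) + j) \<otimes>\<^bsub>T\<^esub> star T (?u (M * (i - 1) + j)) = t (?p i) (?q j)"
    if i: "i \<in> {1..N}" and j: "j \<in> {1..M}" for i j
  proof -
    have "1 \<le> i" using i by simp
    note dm = pair_index_div_mod[OF this j]
    show ?thesis
      unfolding dm using s_closed[OF i] r_closed[OF j] by (simp add: t_star t_mult A.star_closed B.star_closed)
  qed
  have "(\<Oplus>\<^bsub>T\<^esub>k\<in>{1..N * M}. ?u k \<otimes>\<^bsub>T\<^esub> star T (?u k))
      = (\<Oplus>\<^bsub>T\<^esub>i\<in>{1..N}. \<Oplus>\<^bsub>T\<^esub>j\<in>{1..M}. ?u (M * (i - 1) + j) \<otimes>\<^bsub>T\<^esub> star T (?u (M * (i - 1) + j)))"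
    using u_closed T.star_closed by (intro T.finsum_pair_index) auto
  also have "\<dots> = (\<Oplus>\<^bsub>T\<^esub>i\<in>{1..N}. t (?p i) \<one>\<^bsub>B\<^esub>)"
  proof (rule T.finsum_cong')
    fix i assume i: "i \<in> {1..N}"
    have "(\<Oplus>\<^bsub>T\<^esub>j\<in>{1..M}. ?u (M * (i - 1) + j) \<otimes>\<^bsub>T\<^esub> star T (?u (M * (i - 1) + j)))
        = (\<Oplus>\<^bsub>T\<^esub>j\<in>{1..M}. t (?p i) (?q j))"
      using u_pair[OF i] p[OF i] q bilinear_on_closed[OF bil]
      by (intro T.finsum_cong') (auto simp del: One_nat_def)
    also have "\<dots> = t (?p i) (\<Oplus>\<^bsub>B\<^esub>j\<in>{1..M}. ?q j)"
      using p[OF i] q bil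
      by (intro linear_on_finsum[symmetric] B.module_axioms T.module_axioms) (auto simp: bilinear_on_def)
    finally show "(\<Oplus>\<^bsub>T\<^esub>j\<in>{1..M}. ?u (M * (i - 1) + j) \<otimes>\<^bsub>T\<^esub> star T (?u (M * (i - 1) + j)))
        = t (?p i) \<one>\<^bsub>B\<^esub>"
      by (simp only: q_sum)
  qed (use p bilinear_on_closed[OF bil] in auto)
  also have "\<dots> = t (\<Oplus>\<^bsub>A\<^esub>i\<in>{1..N}. ?p i) \<one>\<^bsub>B\<^esub>"
    using p bil
    by (intro linear_on_finsum[where f = "\<lambda>x. t x \<one>\<^bsub>B\<^esub>", symmetric] A.module_axioms T.module_axioms)
      (auto simp: bilinear_on_def)
  finally have "(\<Oplus>\<^bsub>T\<^esub>k\<in>{1..N * M}. ?u k \<otimes>\<^bsub>T\<^esub> star T (?u k)) = \<one>\<^bsub>T\<^esub>"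
    by (simp only: p_sum t_one)
  then show ?thesis
    unfolding cuntz_family_def using u_closed rel by blast
qed

text \<open>As \<open>phi_embedding\<close> is a definite description, unique existence has to be
  established. It is the universal property applied to the product family, after the condition on
  single indices has been translated into one on pairs.\<close>

lemma phi_embedding:
  assumes N: "cuntz_algebra N (Oc N) (s N)" and M: "cuntz_algebra M (Oc M) (s M)"
    and NM: "cuntz_algebra (N * M) (Oc (N * M)) (s (N * M))"
    and t: "cstar_tensor (Oc N) (Oc M) T t"
  shows "star_hom (Oc (N * M)) T (phi_embedding Oc s N M T t)"
    and "\<lbrakk>i \<in> {1..N}; j \<in> {1..M}\<rbrakk> \<Longrightarrow>
      phi_embedding Oc s N M T t (s (N * M) (M * (i - 1) + j)) = t (s N i) (s M j)"
proof -
  let ?u = "\<lambda>k. t (s N ((k - 1) div M + 1)) (s M ((k - 1) mod M + 1))"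
  let ?P = "\<lambda>f. f \<in> extensional (carrier (Oc (N * M))) \<and> star_hom (Oc (N * M)) T f \<and>
    (\<forall>i\<in>{1..N}. \<forall>j\<in>{1..M}. f (s (N * M) (M * (i - 1) + j)) = t (s N i) (s M j))"
  have "cuntz_family (N * M) T ?u" "unital_cstar_algebra T"
    using cuntz_family_tensor[OF _ _ _ _ t] N M t by (auto simp: cuntz_algebra_def cstar_tensor_def)
  then have ex1: "\<exists>!f. f \<in> extensional (carrier (Oc (N * M))) \<and> star_hom (Oc (N * M)) T f \<and>
      (\<forall>k\<in>{1..N * M}. f (s (N * M) k) = ?u k)"
    using NM by (simp add: cuntz_algebra_def)
  have "(\<forall>k\<in>{1..N * M}. f (s (N * M) k) = ?u k) \<longleftrightarrow>
      (\<forall>i\<in>{1..N}. \<forall>j\<in>{1..M}. f (s (N * M) (M * (i - 1) + j)) = t (s N i) (s M j))" for f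
  proof (intro iffI ballI)
    fix i j assume *: "\<forall>k\<in>{1..N * M}. f (s (N * M) k) = ?u k" "i \<in> {1..N}" "j \<in> {1..M}"
    then have "1 \<le> i" by simp
    then show "f (s (N * M) (M * (i - 1) + j)) = t (s N i) (s M j)"
      using *(1)[rule_format, OF pair_index_range[OF *(2,3)]] pair_index_div_mod[OF _ *(3), of i] by simp
  next
    fix k assume *: "\<forall>i\<in>{1..N}. \<forall>j\<in>{1..M}. f (s (N * M) (M * (i - 1) + j)) = t (s N i) (s M j)"
      and k: "k \<in> {1..N * M}"
    show "f (s (N * M) k) = ?u k"
      using *[rule_format, OF pair_index_surj(1,2)[OF k]] unfolding pair_index_surj(3)[OF k] .
  qed
  with ex1 have "\<exists>!f. ?P f" by simp
  then have "?P (phi_embedding Oc s N M T t)"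
    unfolding phi_embedding_def by (rule theI')
  then show "star_hom (Oc (N * M)) T (phi_embedding Oc s N M T t)"
    and "\<lbrakk>i \<in> {1..N}; j \<in> {1..M}\<rbrakk> \<Longrightarrow>
      phi_embedding Oc s N M T t (s (N * M) (M * (i - 1) + j)) = t (s N i) (s M j)"
    by blast+
qed

lemma unital_star_rep_comp:
  assumes f: "star_hom A B f" and rep: "unital_star_rep B (H, \<pi>)"
  shows "unital_star_rep A (rep_comp (H, \<pi>) f)"
proof -
  have hom: "\<And>a. a \<in> carrier A \<Longrightarrow> f a \<in> carrier B"
    "\<And>a b. \<lbrakk>a \<in> carrier A; b \<in> carrier A\<rbrakk> \<Longrightarrow> f (a \<oplus>\<^bsub>A\<^esub> b) = f a \<oplus>\<^bsub>B\<^esub> f b"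
    "\<And>a b. \<lbrakk>a \<in> carrier A; b \<in> carrier A\<rbrakk> \<Longrightarrow> f (a \<otimes>\<^bsub>A\<^esub> b) = f a \<otimes>\<^bsub>B\<^esub> f b"
    "f \<one>\<^bsub>A\<^esub> = \<one>\<^bsub>B\<^esub>"
    "\<And>c a. a \<in> carrier A \<Longrightarrow> f (c \<odot>\<^bsub>A\<^esub> a) = c \<odot>\<^bsub>B\<^esub> f a"
    "\<And>a. a \<in> carrier A \<Longrightarrow> f (star A a) = star B (f a)"
    using f by (auto simp: star_hom_def ring_hom_def linear_on_def)
  show ?thesis
    using rep by (simp add: unital_star_rep_def rep_comp_def hom)
qed

text \<open>This is what later arguments use of a product: the C*-tensor product and the embedding
  are eliminated, and the action of the generators on simple tensors remains.\<close>

lemma phi_tensorD: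
  assumes N: "cuntz_algebra N (Oc N) (s N)" and M: "cuntz_algebra M (Oc M) (s M)"
    and NM: "cuntz_algebra (N * M) (Oc (N * M)) (s (N * M))"
    and R: "phi_tensor Oc s N M (H1, \<pi>1) (H2, \<pi>2) (K, \<rho>)"
  obtains b where "unital_star_rep (Oc (N * M)) (K, \<rho>)" "hilbert_tensor H1 H2 K b"
    and "\<And>i j x y. \<lbrakk>i \<in> {1..N}; j \<in> {1..M}; x \<in> carrier H1; y \<in> carrier H2\<rbrakk> \<Longrightarrow>
      \<rho> (s (N * M) (M * (i - 1) + j)) (b x y) = b (\<pi>1 (s N i) x) (\<pi>2 (s M j) y)"
proof -
  obtain T t b P where t: "cstar_tensor (Oc N) (Oc M) T t"
    and b: "rep_tensor (Oc N) (Oc M) T t b (H1, \<pi>1) (H2, \<pi>2) P"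
    and R: "(K, \<rho>) = rep_comp P (phi_embedding Oc s N M T t)"
    using R unfolding phi_tensor_def by blast
  obtain P' where P: "P = (K, P')" and \<rho>: "\<rho> = P' \<circ> phi_embedding Oc s N M T t"
    using R by (cases P) (auto simp: rep_comp_def)
  note phi = phi_embedding[OF N M NM t]
  have gen: "s N i \<in> carrier (Oc N)" "s M j \<in> carrier (Oc M)" if "i \<in> {1..N}" "j \<in> {1..M}" for i j
    using N M that by (auto simp: cuntz_algebra_def cuntz_family_def)
  show ?thesis
  proof (rule that)
    show "unital_star_rep (Oc (N * M)) (K, \<rho>)"
      unfolding R P using b by (intro unital_star_rep_comp[OF phi(1)]) (simp add: rep_tensor_def P)
    show "hilbert_tensor H1 H2 K b" using b by (simp add: rep_tensor_def P)
    show "\<rho> (s (N * M) (M * (i - 1) + j)) (b x y) = b (\<pi>1 (s N i) x) (\<pi>2 (s M j) y)"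
      if "i \<in> {1..N}" "j \<in> {1..M}" "x \<in> carrier H1" "y \<in> carrier H2" for i j x y
      using b that gen phi(2)[OF that(1,2)] by (simp add: rep_tensor_def P \<rho>)
  qed
qed

section \<open>Iterated products\<close>

text \<open>Tuples are functions on all of \<open>nat\<close>, so the first clause says that
  \<open>E\<close> depends on the coordinates from 1 to \<open>m\<close> only. Gram matrix and
  totality take the place of multilinearity, being what \<open>unitary_of_gram\<close> asks
  for.\<close>

definition multi_tensor :: "nat \<Rightarrow> (nat \<Rightarrow> 'h hilbert) \<Rightarrow> 'h hilbert \<Rightarrow> ((nat \<Rightarrow> 'h) \<Rightarrow> 'h) \<Rightarrow> bool" where
  "multi_tensor m H K E \<longleftrightarrow>
     (\<forall>x y. (\<forall>k\<in>{1..m}. x k = y k) \<longrightarrow> E x = E y) \<and>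
     (\<forall>x y. (\<forall>k\<in>{1..m}. x k \<in> carrier (H k) \<and> y k \<in> carrier (H k)) \<longrightarrow>
        iprod K (E x) (E y) = (\<Prod>k=1..m. iprod (H k) (x k) (y k))) \<and>
     total K (hnorm K) (E ` {x. \<forall>k\<in>{1..m}. x k \<in> carrier (H k)})"

lemma multi_tensorD:
  assumes "multi_tensor m H K E"
  shows "(\<And>k. k \<in> {1..m} \<Longrightarrow> x k = y k) \<Longrightarrow> E x = E y"
    and "(\<And>k. k \<in> {1..m} \<Longrightarrow> x k \<in> carrier (H k)) \<Longrightarrow> (\<And>k. k \<in> {1..m} \<Longrightarrow> y k \<in> carrier (H k)) \<Longrightarrow>
        iprod K (E x) (E y) = (\<Prod>k=1..m. iprod (H k) (x k) (y k))"
    and "total K (hnorm K) (E ` {x. \<forall>k\<in>{1..m}. x k \<in> carrier (H k)})"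
    and "(\<And>k. k \<in> {1..m} \<Longrightarrow> x k \<in> carrier (H k)) \<Longrightarrow> E x \<in> carrier K"
proof -
  show total: "total K (hnorm K) (E ` {x. \<forall>k\<in>{1..m}. x k \<in> carrier (H k)})"
    using assms by (simp add: multi_tensor_def)
  show "E x = E y" if "\<And>k. k \<in> {1..m} \<Longrightarrow> x k = y k"
    using assms that unfolding multi_tensor_def by blast
  show "iprod K (E x) (E y) = (\<Prod>k=1..m. iprod (H k) (x k) (y k))"
    if "\<And>k. k \<in> {1..m} \<Longrightarrow> x k \<in> carrier (H k)" "\<And>k. k \<in> {1..m} \<Longrightarrow> y k \<in> carrier (H k)"
    using assms that unfolding multi_tensor_def by blast
  show "E x \<in> carrier K" if "\<And>k. k \<in> {1..m} \<Longrightarrow> x k \<in> carrier (H k)"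
    using total that by (auto simp: total_def)
qed

lemma total_carrier: "total V nrm (carrier V)"
  by (auto simp: total_def submodule_def subgroup_def)

lemma multi_tensor_one: "multi_tensor 1 H (H 1) (\<lambda>x. x 1)"
proof -
  have "(\<lambda>x. x 1) ` {x. \<forall>k\<in>{1..1::nat}. x k \<in> carrier (H k)} = carrier (H 1)"
    by (force simp: image_iff)
  then show ?thesis
    by (auto simp: multi_tensor_def total_carrier)
qed

lemma hnorm_tensor:
  assumes K: "hilbert_tensor H1 H2 K b" and H: "hilbert_space H1" "hilbert_space H2"
    and x: "x \<in> carrier H1" and y: "y \<in> carrier H2"
  shows "hnorm K (b x y) = hnorm H1 x * hnorm H2 y"
proof -
  have "iprod K (b x y) (b x y) = iprod H1 x x * iprod H2 y y"
    using K x y by (auto simp: hilbert_tensor_def)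
  then have "iprod K (b x y) (b x y) = of_real ((hnorm H1 x * hnorm H2 y)\<^sup>2)"
    using hilbert_space.iprod_self[OF H(1) x] hilbert_space.iprod_self[OF H(2) y]
    by (simp add: power_mult_distrib)
  then show ?thesis
    using hilbert_space.hnorm_nonneg[OF H(1) x] hilbert_space.hnorm_nonneg[OF H(2) y]
    by (simp add: hnorm_def[of K] del: of_real_power)
qed

text \<open>The substantial part is totality. Let a closed submodule \<open>W\<close> contain the
  new tensors. For fixed \<open>y\<close>, the vectors \<open>z\<close> with \<open>b z y\<close> in
  \<open>W\<close> form a closed submodule of \<open>K\<close> containing all old tensors, hence all
  of \<open>K\<close>. So \<open>W\<close> contains every simple tensor, and these are
  total.\<close>

lemma multi_tensor_Suc:
  assumes E: "multi_tensor m H K E" and b: "hilbert_tensor K (H (Suc m)) L b"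
    and K: "hilbert_space K" and H: "hilbert_space (H (Suc m))"
  shows "multi_tensor (Suc m) H L (\<lambda>x. b (E x) (x (Suc m)))"
proof -
  interpret K: hilbert_space K by (rule K)
  interpret H: hilbert_space "H (Suc m)" by (rule H)
  interpret L: hilbert_space L using b by (simp add: hilbert_tensor_def)
  let ?Z = "\<lambda>m. {x. \<forall>k\<in>{1..m}. x k \<in> carrier (H k)}"
  have set_Suc: "{1..Suc m} = insert (Suc m) {1..m}" by auto
  note E' = multi_tensorD[OF E]
  have bil: "bilinear_on K (H (Suc m)) L b"
    and total_L: "total L (hnorm L) {b x y |x y. x \<in> carrier K \<and> y \<in> carrier (H (Suc m))}"
    using b by (auto simp: hilbert_tensor_def)
  have "b (E x) (x (Suc m)) = b (E y) (y (Suc m))" if "\<forall>k\<in>{1..Suc m}. x k = y k" for x y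
    using that E'(1)[of x y] by simp
  moreover have "iprod L (b (E x) (x (Suc m))) (b (E y) (y (Suc m))) =
      (\<Prod>k=1..Suc m. iprod (H k) (x k) (y k))"
    if xy: "\<forall>k\<in>{1..Suc m}. x k \<in> carrier (H k) \<and> y k \<in> carrier (H k)" for x y
  proof -
    have "E x \<in> carrier K" "E y \<in> carrier K" using xy by (auto intro!: E'(4))
    then have "iprod L (b (E x) (x (Suc m))) (b (E y) (y (Suc m))) =
        iprod K (E x) (E y) * iprod (H (Suc m)) (x (Suc m)) (y (Suc m))"
      using b xy by (simp add: hilbert_tensor_def)
    also have "iprod K (E x) (E y) = (\<Prod>k=1..m. iprod (H k) (x k) (y k))"
      using xy by (intro E'(2)) auto
    finally show ?thesis by simp
  qed
  moreover have "total L (hnorm L) ((\<lambda>x. b (E x) (x (Suc m))) ` ?Z (Suc m))"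
    unfolding total_def
  proof (intro conjI allI impI)
    show "(\<lambda>x. b (E x) (x (Suc m))) ` ?Z (Suc m) \<subseteq> carrier L"
      using bilinear_on_closed[OF bil] E'(4) by auto
  next
    fix W assume "submodule W complex_ring L \<and> norm_closed L (hnorm L) W \<and>
      (\<lambda>x. b (E x) (x (Suc m))) ` ?Z (Suc m) \<subseteq> W"
    then have W: "closed_submodule L (hnorm L) W"
      and sub: "\<And>x. x \<in> ?Z (Suc m) \<Longrightarrow> b (E x) (x (Suc m)) \<in> W"
      by (auto simp: closed_submodule_def)
    have "b z y \<in> W" if z: "z \<in> carrier K" and y: "y \<in> carrier (H (Suc m))" for z y
    proof -
      have "{z \<in> carrier K. b z y \<in> W} = carrier K"
      proof (rule total_closed_submodule[OF E'(3)])
        show "closed_submodule K (hnorm K) {z \<in> carrier K. b z y \<in> W}"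
        proof (rule closed_submodule_vimage[OF K.normed_module_axioms L.normed_module_axioms _ _ W])
          show "linear_on K L (\<lambda>z. b z y)" using bil y by (simp add: bilinear_on_def)
          show "hnorm L (b x y) \<le> hnorm (H (Suc m)) y * hnorm K x" if "x \<in> carrier K" for x
            using hnorm_tensor[OF b K H that y] by (simp add: mult.commute)
        qed
        show "E ` ?Z m \<subseteq> {z \<in> carrier K. b z y \<in> W}"
        proof clarify
          fix x assume x: "\<forall>k\<in>{1..m}. x k \<in> carrier (H k)"
          \<comment> \<open>The new coordinate carries \<open>y\<close>; changing it does not affect
            \<open>E\<close>, by the first clause of \<open>multi_tensor\<close>.\<close>
          have "x(Suc m := y) \<in> ?Z (Suc m)" using x y by (auto simp: set_Suc)
          then have "b (E (x(Suc m := y))) y \<in> W" using sub[of "x(Suc m := y)"] by simp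
          moreover have "E (x(Suc m := y)) = E x" by (rule E'(1)) auto
          ultimately show "E x \<in> carrier K \<and> b (E x) y \<in> W" using x E'(4) by auto
        qed
      qed
      then show ?thesis using z by blast
    qed
    then show "W = carrier L"
      by (intro total_closed_submodule[OF total_L W]) blast
  qed
  ultimately show ?thesis
    unfolding multi_tensor_def by blast
qed

section \<open>Mixed-radix numerals\<close>

text \<open>The Horner scheme for a mixed-radix numeral, with digits and values counted from 1. The
  empty numeral has value 1, so that a single digit is its own value.\<close>

fun mixed_index :: "(nat \<Rightarrow> nat) \<Rightarrow> (nat \<Rightarrow> nat) \<Rightarrow> nat \<Rightarrow> nat" where
  "mixed_index \<nu> i 0 = 1"
| "mixed_index \<nu> i (Suc m) = \<nu> (Suc m) * (mixed_index \<nu> i m - 1) + i (Suc m)"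

lemma mixed_index_range:
  "(\<And>k. k \<in> {1..m} \<Longrightarrow> i k \<in> {1..\<nu> k}) \<Longrightarrow> mixed_index \<nu> i m \<in> {1..\<Prod>k=1..m. \<nu> k}"
proof (induction m)
  case (Suc m)
  have "mixed_index \<nu> i m \<in> {1..\<Prod>k=1..m. \<nu> k}"
    using Suc.prems by (intro Suc.IH) simp
  moreover have "i (Suc m) \<in> {1..\<nu> (Suc m)}"
    using Suc.prems[of "Suc m"] by simp
  ultimately have *: "mixed_index \<nu> i m \<in> {1..\<Prod>k=1..m. \<nu> k}" "i (Suc m) \<in> {1..\<nu> (Suc m)}" .
  from pair_index_range[OF *] show ?case by simp
qed simp

lemma mixed_index_inj:
  assumes "\<And>k. k \<in> {1..m} \<Longrightarrow> i k \<in> {1..\<nu> k}" "\<And>k. k \<in> {1..m} \<Longrightarrow> i' k \<in> {1..\<nu> k}"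
    and "mixed_index \<nu> i m = mixed_index \<nu> i' m" and "k \<in> {1..m}"
  shows "i k = i' k"
  using assms
proof (induction m arbitrary: k)
  case (Suc m)
  have range: "1 \<le> mixed_index \<nu> i m" "1 \<le> mixed_index \<nu> i' m"
    using mixed_index_range[of m i \<nu>] mixed_index_range[of m i' \<nu>] Suc.prems(1,2) by auto
  have last: "i (Suc m) \<in> {1..\<nu> (Suc m)}" "i' (Suc m) \<in> {1..\<nu> (Suc m)}"
    using Suc.prems by auto
  have "mixed_index \<nu> i m = mixed_index \<nu> i' m" "i (Suc m) = i' (Suc m)"
    using pair_index_div_mod[OF range(1) last(1)] pair_index_div_mod[OF range(2) last(2)] Suc.prems(3)
    by simp_all
  then show ?case
    using Suc.IH[of k] Suc.prems by (cases "k = Suc m") auto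
qed simp

lemma mixed_index_surj:
  assumes "j \<in> {1..\<Prod>k=1..m. \<nu> k}"
  shows "\<exists>i. (\<forall>k\<in>{1..m}. i k \<in> {1..\<nu> k}) \<and> mixed_index \<nu> i m = j"
  using assms
proof (induction m arbitrary: j)
  case (Suc m)
  then have j: "j \<in> {1..(\<Prod>k=1..m. \<nu> k) * \<nu> (Suc m)}" by simp
  note dm = pair_index_surj[OF j]
  obtain i where i: "\<forall>k\<in>{1..m}. i k \<in> {1..\<nu> k}" "mixed_index \<nu> i m = (j - 1) div \<nu> (Suc m) + 1"
    using Suc.IH[OF dm(1)] by blast
  let ?i = "i(Suc m := (j - 1) mod \<nu> (Suc m) + 1)"
  have cong: "mixed_index \<nu> ?i l = mixed_index \<nu> i l" if "l \<le> m" for l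
    using that by (induction l) auto
  have "mixed_index \<nu> ?i (Suc m) = j"
    unfolding mixed_index.simps cong[OF order_refl] i(2) fun_upd_same by (rule dm(3))
  moreover have "\<forall>k\<in>{1..Suc m}. ?i k \<in> {1..\<nu> k}"
    using i(1) dm(2) by (auto simp: le_Suc_eq)
  ultimately show ?case by blast
qed simp

lemma mixed_index_cong:
  "(\<And>k. k \<in> {1..m} \<Longrightarrow> i k = i' k) \<Longrightarrow> mixed_index \<nu> i m = mixed_index \<nu> i' m"
  by (induction m) auto

text \<open>Induction along the left bracketing, starting from one factor. Each new factor appends a
  digit by \<open>M * (i - 1) + j\<close>, which is the Horner step. The bound \<open>2 <= L\<close>
  is carried along because Cuntz algebras are given from two generators on, and the representation
  property because the next tensor product requires its first factor to be a Hilbert space.\<close>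

lemma phi_product_tensor:
  assumes cuntz: "\<And>k. k \<ge> 2 \<Longrightarrow> cuntz_algebra k (Oc k) (s k)"
    and m: "m \<ge> 1"
    and \<nu>: "\<And>k. k \<in> {1..m} \<Longrightarrow> \<nu> k \<ge> 2"
    and reps: "\<And>k. k \<in> {1..m} \<Longrightarrow> unital_star_rep (Oc (\<nu> k)) (\<rho> k)"
    and prod: "phi_product Oc s (map (\<lambda>k. (\<nu> k, \<rho> k)) [1..<m+1]) (L, R)"
  shows "L = (\<Prod>k=1..m. \<nu> k) \<and> 2 \<le> L \<and> unital_star_rep (Oc L) R \<and>
    (\<exists>E. multi_tensor m (\<lambda>k. fst (\<rho> k)) (fst R) E \<and>
      (\<forall>i x. (\<forall>k\<in>{1..m}. i k \<in> {1..\<nu> k} \<and> x k \<in> carrier (fst (\<rho> k))) \<longrightarrow>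
        snd R (s L (mixed_index \<nu> i m)) (E x) = E (\<lambda>k. snd (\<rho> k) (s (\<nu> k) (i k)) (x k))))"
  using m \<nu> reps prod
proof (induction m arbitrary: L R rule: nat_induct_at_least)
  case base
  \<comment> \<open>The rule \<open>snoc\<close> would require a product of the empty list, which
    has no derivation.\<close>
  have "L = \<nu> 1 \<and> R = \<rho> 1"
    using base(3) by (cases rule: phi_product.cases) (auto elim: phi_product.cases)
  moreover have "\<nu> 1 \<ge> 2" "unital_star_rep (Oc (\<nu> 1)) (\<rho> 1)" using base by auto
  moreover have "mixed_index \<nu> i 1 = i 1" for i by simp
  ultimately show ?case
    using multi_tensor_one[of "\<lambda>k. fst (\<rho> k)"]
    by (intro conjI exI[of _ "\<lambda>x. x 1"]) (simp_all del: One_nat_def)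
next
  case (Suc m)
  let ?\<rho> = "\<rho> (Suc m)" and ?N = "\<nu> (Suc m)"
  have list: "map (\<lambda>k. (\<nu> k, \<rho> k)) [1..<Suc m + 1] = map (\<lambda>k. (\<nu> k, \<rho> k)) [1..<m+1] @ [(?N, ?\<rho>)]"
    by simp
  \<comment> \<open>This rules out \<open>single\<close> when the product is taken apart.\<close>
  have nonempty: "map (\<lambda>k. (\<nu> k, \<rho> k)) [1..<m+1] \<noteq> []" using Suc.hyps by simp
  obtain L1 R1 where R1: "phi_product Oc s (map (\<lambda>k. (\<nu> k, \<rho> k)) [1..<m+1]) (L1, R1)"
    and R: "phi_tensor Oc s L1 ?N R1 ?\<rho> R" and L: "L = L1 * ?N"
    using Suc.prems(3) unfolding list
  proof (cases rule: phi_product.cases)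
    case (snoc Rs N R1 M R2)
    then show thesis using that by (simp del: upt_Suc)
  qed (use nonempty in \<open>simp del: upt_Suc\<close>)
  have N: "?N \<ge> 2" and rep: "unital_star_rep (Oc ?N) ?\<rho>" using Suc.prems by auto
  have "\<nu> k \<ge> 2" "unital_star_rep (Oc (\<nu> k)) (\<rho> k)" if "k \<in> {1..m}" for k
    using that Suc.prems(1,2)[of k] by simp_all
  from Suc.IH[OF this R1]
  have L1: "L1 = (\<Prod>k=1..m. \<nu> k)" "2 \<le> L1" and rep1: "unital_star_rep (Oc L1) R1"
    and ex_E: "\<exists>E. multi_tensor m (\<lambda>k. fst (\<rho> k)) (fst R1) E \<and>
      (\<forall>i x. (\<forall>k\<in>{1..m}. i k \<in> {1..\<nu> k} \<and> x k \<in> carrier (fst (\<rho> k))) \<longrightarrow>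
        snd R1 (s L1 (mixed_index \<nu> i m)) (E x) = E (\<lambda>k. snd (\<rho> k) (s (\<nu> k) (i k)) (x k)))"
    by blast+
  obtain E where E: "multi_tensor m (\<lambda>k. fst (\<rho> k)) (fst R1) E"
    and act: "\<And>i x. (\<forall>k\<in>{1..m}. i k \<in> {1..\<nu> k} \<and> x k \<in> carrier (fst (\<rho> k))) \<Longrightarrow>
        snd R1 (s L1 (mixed_index \<nu> i m)) (E x) = E (\<lambda>k. snd (\<rho> k) (s (\<nu> k) (i k)) (x k))"
    using ex_E by blast
  have L2: "2 \<le> L" using L1(2) N mult_le_mono[of 2 L1 1 ?N] by (simp add: L)
  have pairs: "(fst R1, snd R1) = R1" "(fst ?\<rho>, snd ?\<rho>) = ?\<rho>" "(fst R, snd R) = R" by simp_all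
  obtain b where repR: "unital_star_rep (Oc L) R" and b: "hilbert_tensor (fst R1) (fst ?\<rho>) (fst R) b"
    and act_b: "\<And>i j x y. \<lbrakk>i \<in> {1..L1}; j \<in> {1..?N}; x \<in> carrier (fst R1); y \<in> carrier (fst ?\<rho>)\<rbrakk> \<Longrightarrow>
      snd R (s L (?N * (i - 1) + j)) (b x y) = b (snd R1 (s L1 i) x) (snd ?\<rho> (s ?N j) y)"
    using phi_tensorD[OF cuntz[OF L1(2)] cuntz[OF N] cuntz[OF L2, unfolded L],
        of "fst R1" "snd R1" "fst ?\<rho>" "snd ?\<rho>" "fst R" "snd R"] R
    unfolding pairs L by metis
  have H: "hilbert_space (fst R1)" "hilbert_space (fst ?\<rho>)"
    using rep1 rep by (auto simp: unital_star_rep_def split: prod.splits)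
  let ?E = "\<lambda>x. b (E x) (x (Suc m))"
  have "multi_tensor (Suc m) (\<lambda>k. fst (\<rho> k)) (fst R) ?E"
    using E b H by (rule multi_tensor_Suc)
  moreover have "snd R (s L (mixed_index \<nu> i (Suc m))) (?E x) =
      ?E (\<lambda>k. snd (\<rho> k) (s (\<nu> k) (i k)) (x k))"
    if ix: "\<forall>k\<in>{1..Suc m}. i k \<in> {1..\<nu> k} \<and> x k \<in> carrier (fst (\<rho> k))" for i x
  proof -
    have ix_m: "\<forall>k\<in>{1..m}. i k \<in> {1..\<nu> k} \<and> x k \<in> carrier (fst (\<rho> k))"
      and last: "i (Suc m) \<in> {1..?N}" "x (Suc m) \<in> carrier (fst ?\<rho>)"
      using ix by auto
    have "mixed_index \<nu> i m \<in> {1..L1}"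
      unfolding L1(1) using ix_m by (intro mixed_index_range) blast
    moreover have "E x \<in> carrier (fst R1)"
      using multi_tensorD(4)[OF E] ix_m by blast
    ultimately show ?thesis
      using act_b last act[OF ix_m] by simp
  qed
  moreover have "L = (\<Prod>k=1..Suc m. \<nu> k)" by (simp add: L L1(1))
  ultimately show ?case using L2 repR by blast
qed

section \<open>Relabelling the generators\<close>

lemma tau_apply: "tau N \<sigma> k a b = N (\<sigma> k) * (a - 1) + b"
  by (simp add: tau_def pair_index_def)

text \<open>The invariant of the fold: after the maps for 2 to \<open>m\<close>, the head of the
  list is the value of the first \<open>m\<close> digits and the tail is untouched. At
  \<open>m = 1\<close> no map has been applied yet.\<close>

lemma multi_index_eq_mixed_index:
  assumes "n \<ge> 1"
  shows "multi_index N n \<sigma> i = mixed_index (\<lambda>k. N (\<sigma> k)) (\<lambda>k. i (\<sigma> k)) n"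
proof -
  let ?c = "\<lambda>k. i (\<sigma> k)" and ?J = "mixed_index (\<lambda>k. N (\<sigma> k)) (\<lambda>k. i (\<sigma> k))"
  have "m \<le> n \<longrightarrow> fold (\<lambda>k. apply_first_two (tau N \<sigma> k)) [2..<m+1] (map ?c [1..<n+1]) =
      ?J m # map ?c [m+1..<n+1]" if "m \<ge> 1" for m
    using that
  proof (induction m rule: nat_induct_at_least)
    case base
    have "[1..<n+1] = 1 # [Suc 1..<n+1]" using assms by (intro upt_conv_Cons) simp
    then show ?case by (simp del: upt_Suc)
  next
    case (Suc m)
    show ?case
    proof
      assume m: "Suc m \<le> n"
      have snoc: "[2..<Suc m + 1] = [2..<m+1] @ [Suc m]" using Suc.hyps by simp
      have Cons: "[m+1..<n+1] = Suc m # [Suc m + 1..<n+1]"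
        using m upt_conv_Cons[of "Suc m" "n + 1"] by simp
      have IH: "fold (\<lambda>k. apply_first_two (tau N \<sigma> k)) [2..<m+1] (map ?c [1..<n+1]) =
          ?J m # map ?c [m+1..<n+1]"
        using Suc.IH m by (meson Suc_leD)
      have "fold (\<lambda>k. apply_first_two (tau N \<sigma> k)) [2..<Suc m + 1] (map ?c [1..<n+1]) =
          apply_first_two (tau N \<sigma> (Suc m)) (?J m # map ?c [m+1..<n+1])"
        unfolding snoc fold_append by (simp only: comp_apply fold_simps IH)
      then show "fold (\<lambda>k. apply_first_two (tau N \<sigma> k)) [2..<Suc m + 1] (map ?c [1..<n+1]) =
          ?J (Suc m) # map ?c [Suc m + 1..<n+1]"
        unfolding Cons by (simp add: tau_apply del: upt_Suc)
    qed
  qed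
  from this[OF assms] show ?thesis by (simp add: multi_index_def del: upt_Suc)
qed

text \<open>In the order \<sigma> a multi-index is a numeral with digits
  \<open>i (\<sigma> k)\<close> in the radices \<open>N (\<sigma> k)\<close>. The range does not
  depend on \<sigma> because the product of the radices does not. Injectivity is stated on
  extensional functions, as only coordinates in \<open>{1..n}\<close> influence the value.\<close>

lemma multi_index_bij:
  assumes n: "n \<ge> 1" and \<sigma>: "\<sigma> permutes {1..n}"
  shows "bij_betw (multi_index N n \<sigma>) (\<Pi>\<^sub>E k\<in>{1..n}. {1..N k}) {1..\<Prod>i=1..n. N i}"
proof -
  have \<sigma>_in: "\<sigma> k \<in> {1..n}" if "k \<in> {1..n}" for k
    using permutes_in_image[OF \<sigma>, of k] that by simp
  have prod: "(\<Prod>k=1..n. N (\<sigma> k)) = (\<Prod>i=1..n. N i)"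
    using prod.permute[OF \<sigma>, of N] by (simp add: comp_def)
  show ?thesis
    unfolding bij_betw_def
  proof
    show "inj_on (multi_index N n \<sigma>) (\<Pi>\<^sub>E k\<in>{1..n}. {1..N k})"
    proof (rule inj_onI)
      fix i i' assume i: "i \<in> (\<Pi>\<^sub>E k\<in>{1..n}. {1..N k})" "i' \<in> (\<Pi>\<^sub>E k\<in>{1..n}. {1..N k})"
        and eq: "multi_index N n \<sigma> i = multi_index N n \<sigma> i'"
      have "i (\<sigma> k) = i' (\<sigma> k)" if "k \<in> {1..n}" for k
        using eq unfolding multi_index_eq_mixed_index[OF n]
        by (rule mixed_index_inj[rotated 2]) (use that i \<sigma>_in in blast)+
      then have "i k = i' k" if "k \<in> {1..n}" for k
        using that permutes_image[OF \<sigma>] by (metis image_iff)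
      with i show "i = i'" by (blast intro: PiE_ext)
    qed
    show "multi_index N n \<sigma> ` (\<Pi>\<^sub>E k\<in>{1..n}. {1..N k}) = {1..\<Prod>i=1..n. N i}"
    proof
      show "multi_index N n \<sigma> ` (\<Pi>\<^sub>E k\<in>{1..n}. {1..N k}) \<subseteq> {1..\<Prod>i=1..n. N i}"
        unfolding multi_index_eq_mixed_index[OF n] prod[symmetric]
        using \<sigma>_in by (intro image_subsetI mixed_index_range) blast
      show "{1..\<Prod>i=1..n. N i} \<subseteq> multi_index N n \<sigma> ` (\<Pi>\<^sub>E k\<in>{1..n}. {1..N k})"
      proof
        fix j assume "j \<in> {1..\<Prod>i=1..n. N i}"
        then obtain c where c: "\<forall>k\<in>{1..n}. c k \<in> {1..N (\<sigma> k)}" "mixed_index (\<lambda>k. N (\<sigma> k)) c n = j"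
          using mixed_index_surj[of j "\<lambda>k. N (\<sigma> k)" n] prod by auto
        \<comment> \<open>Undo the permutation of the digits; the restriction makes the result
          extensional.\<close>
        define i where "i = restrict (\<lambda>k. c (inv_into UNIV \<sigma> k)) {1..n}"
        have "inv_into UNIV \<sigma> k \<in> {1..n}" if "k \<in> {1..n}" for k
          using permutes_in_image[OF permutes_inv[OF \<sigma>], of k] that by simp
        then have "i \<in> (\<Pi>\<^sub>E k\<in>{1..n}. {1..N k})"
          unfolding i_def using c(1) permutes_inverses(1)[OF \<sigma>] by fastforce
        moreover have "multi_index N n \<sigma> i = j"
          unfolding multi_index_eq_mixed_index[OF n] c(2)[symmetric]
          by (rule mixed_index_cong) (use \<sigma>_in in \<open>simp add: i_def permutes_inverses(2)[OF \<sigma>]\<close>)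
        ultimately show "j \<in> multi_index N n \<sigma> ` (\<Pi>\<^sub>E k\<in>{1..n}. {1..N k})" by blast
      qed
    qed
  qed
qed

section \<open>Homomorphisms out of Cuntz algebras\<close>

lemma star_hom_comp:
  assumes "star_hom A B f" "star_hom B C g"
  shows "star_hom A C (\<lambda>x. g (f x))"
  using assms by (auto simp: star_hom_def ring_hom_def linear_on_def Pi_iff)

lemma star_hom_restrict:
  assumes A: "unital_cstar_algebra A" and f: "star_hom A B f"
  shows "star_hom A B (restrict f (carrier A))"
proof -
  interpret A: unital_cstar_algebra A by fact
  show ?thesis
    using f by (simp add: star_hom_def ring_hom_def linear_on_def Pi_iff A.star_closed)
qed

lemma cuntz_family_permute:
  assumes A: "unital_cstar_algebra A" and s: "cuntz_family M A s" and p: "bij_betw p {1..M} {1..M}"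
  shows "cuntz_family M A (\<lambda>k. s (p k))"
proof -
  interpret A: unital_cstar_algebra A by fact
  have p_in: "p k \<in> {1..M}" if "k \<in> {1..M}" for k using bij_betwE[OF p] that by blast
  have inj: "p k = p l \<longleftrightarrow> k = l" if "k \<in> {1..M}" "l \<in> {1..M}" for k l
    using bij_betw_imp_inj_on[OF p] that by (rule inj_on_eq_iff)
  have s_closed: "\<And>k. k \<in> {1..M} \<Longrightarrow> s k \<in> carrier A" using s by (auto simp: cuntz_family_def)
  have image: "p ` {1..M} = {1..M}" using p by (simp add: bij_betw_def)
  have "(\<Oplus>\<^bsub>A\<^esub>k\<in>p ` {1..M}. s k \<otimes>\<^bsub>A\<^esub> star A (s k)) = (\<Oplus>\<^bsub>A\<^esub>k\<in>{1..M}. s (p k) \<otimes>\<^bsub>A\<^esub> star A (s (p k)))"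
    using p s_closed A.star_closed by (intro A.finsum_reindex) (auto simp: image bij_betw_def)
  then show ?thesis
    using s p_in inj s_closed unfolding cuntz_family_def image by simp
qed

text \<open>Uniqueness in \<open>cuntz_algebra\<close> holds among extensional functions, so both
  maps are first restricted to the carrier.\<close>

lemma cuntz_algebra_hom_eq:
  fixes A B :: "'a cstar"
  assumes A: "cuntz_algebra M A s" and B: "unital_cstar_algebra B" and u: "cuntz_family M B u"
    and f: "star_hom A B f" "\<forall>k\<in>{1..M}. f (s k) = u k"
    and g: "star_hom A B g" "\<forall>k\<in>{1..M}. g (s k) = u k"
    and a: "a \<in> carrier A"
  shows "f a = g a"
proof -
  have alg: "unital_cstar_algebra A" and gen: "\<And>k. k \<in> {1..M} \<Longrightarrow> s k \<in> carrier A"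
    using A by (auto simp: cuntz_algebra_def cuntz_family_def)
  have "\<exists>!h. h \<in> extensional (carrier A) \<and> star_hom A B h \<and> (\<forall>k\<in>{1..M}. h (s k) = u k)"
    using A B u by (simp add: cuntz_algebra_def)
  moreover have "restrict f (carrier A) \<in> extensional (carrier A) \<and> star_hom A B (restrict f (carrier A)) \<and>
      (\<forall>k\<in>{1..M}. restrict f (carrier A) (s k) = u k)"
    using f gen star_hom_restrict[OF alg] by simp
  moreover have "restrict g (carrier A) \<in> extensional (carrier A) \<and> star_hom A B (restrict g (carrier A)) \<and>
      (\<forall>k\<in>{1..M}. restrict g (carrier A) (s k) = u k)"
    using g gen star_hom_restrict[OF alg] by simp
  ultimately have "restrict f (carrier A) = restrict g (carrier A)" by blast
  then show ?thesis using a by (metis restrict_apply')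
qed

section \<open>From generators to the whole algebra\<close>

lemma unital_star_rep_intertwiner:
  assumes A: "cuntz_algebra M A s" and H: "unital_star_rep A (H, \<pi>)" and K: "unital_star_rep A (K, \<rho>)"
    and U: "unitary H K U"
    and gen: "\<And>k x. \<lbrakk>k \<in> {1..M}; x \<in> carrier H\<rbrakk> \<Longrightarrow> U (\<pi> (s k) x) = \<rho> (s k) (U x)"
    and a: "a \<in> carrier A" and x: "x \<in> carrier H"
  shows "U (\<pi> a x) = \<rho> a (U x)"
proof -
  have alg: "unital_cstar_algebra A"
    and univ: "\<And>B. cstar_subalgebra A B \<Longrightarrow> s ` {1..M} \<subseteq> B \<Longrightarrow> B = carrier A"
    and s: "s ` {1..M} \<subseteq> carrier A"
    using A by (auto simp: cuntz_algebra_def cuntz_family_def)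
  interpret A: unital_cstar_algebra A by (rule alg)
  note \<pi> = unital_star_repD[OF H] and \<rho> = unital_star_repD[OF K]
  interpret H: hilbert_space H by (rule \<pi>(1))
  interpret K: hilbert_space K by (rule \<rho>(1))
  have lin: "linear_on H K U" and surj: "U ` carrier H = carrier K"
    and iprod_U: "\<And>x y. \<lbrakk>x \<in> carrier H; y \<in> carrier H\<rbrakk> \<Longrightarrow> iprod K (U x) (U y) = iprod H x y"
    using U by (auto simp: unitary_def bij_betw_def)
  have norm_U: "hnorm K (U x) = hnorm H x" if "x \<in> carrier H" for x
    using iprod_U[OF that that] by (simp add: hnorm_def)
  have U_closed: "U x \<in> carrier K" if "x \<in> carrier H" for x using lin that by auto
  have \<pi>_closed: "\<pi> a x \<in> carrier H" if "a \<in> carrier A" "x \<in> carrier H" for a x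
    using \<pi>(2)[OF that(1)] that(2) by auto
  have \<rho>_closed: "\<rho> a y \<in> carrier K" if "a \<in> carrier A" "y \<in> carrier K" for a y
    using \<rho>(2)[OF that(1)] that(2) by auto
  define B where "B = {a \<in> carrier A. \<forall>x\<in>carrier H. U (\<pi> a x) = \<rho> a (U x)}"
  have add: "a \<oplus>\<^bsub>A\<^esub> b \<in> B" if "a \<in> B" "b \<in> B" for a b
    using that by (simp add: B_def \<pi>(3) \<rho>(3) linear_on_add[OF lin] \<pi>_closed U_closed)
  have smult: "c \<odot>\<^bsub>A\<^esub> a \<in> B" if "a \<in> B" for a c
    using that by (simp add: B_def \<pi>(4) \<rho>(4) linear_on_smult[OF lin] \<pi>_closed U_closed)
  have mult: "a \<otimes>\<^bsub>A\<^esub> b \<in> B" if "a \<in> B" "b \<in> B" for a b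
    using that by (simp add: B_def \<pi>(5) \<rho>(5) \<pi>_closed U_closed)
  have one: "\<one>\<^bsub>A\<^esub> \<in> B" by (simp add: B_def \<pi>(6) \<rho>(6) U_closed)
  have B_sub: "B \<subseteq> carrier A" by (auto simp: B_def)
  \<comment> \<open>Every \<open>y\<close> in \<open>K\<close> has the form \<open>U z\<close>.
    Moved to the other side of the inner product, \<open>star A a\<close> turns into
    \<open>a\<close>, for which the intertwining relation is known.\<close>
  have star: "star A a \<in> B" if "a \<in> B" for a
  proof -
    have a: "a \<in> carrier A" "star A a \<in> carrier A" using that A.star_closed by (auto simp: B_def)
    have "U (\<pi> (star A a) x) = \<rho> (star A a) (U x)" if x: "x \<in> carrier H" for x
    proof -
      have "iprod K y (U (\<pi> (star A a) x) \<ominus>\<^bsub>K\<^esub> \<rho> (star A a) (U x)) = 0" if "y \<in> carrier K" for y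
      proof -
        from that[folded surj] obtain z where z: "z \<in> carrier H" "y = U z" by (rule imageE) simp
        have "iprod K y (U (\<pi> (star A a) x)) = iprod H (\<pi> a z) x"
          using z x a by (simp add: iprod_U \<pi>_closed \<pi>(7))
        also have "\<dots> = iprod K (U (\<pi> a z)) (U x)"
          using z x a by (simp add: iprod_U \<pi>_closed)
        also have "U (\<pi> a z) = \<rho> a y"
          using \<open>a \<in> B\<close> z by (simp add: B_def)
        also have "iprod K (\<rho> a y) (U x) = iprod K y (\<rho> (star A a) (U x))"
          using that x a by (simp add: \<rho>(7) U_closed)
        finally show ?thesis
          using that x a by (simp add: K.iprod_minus U_closed \<pi>_closed \<rho>_closed)
      qed
      then have "U (\<pi> (star A a) x) \<ominus>\<^bsub>K\<^esub> \<rho> (star A a) (U x) = \<zero>\<^bsub>K\<^esub>"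
        using x a by (intro K.iprod_definite) (simp_all add: U_closed \<pi>_closed \<rho>_closed)
      then show ?thesis
        using x a by (simp add: K.minus_eq_zero_iff U_closed \<pi>_closed \<rho>_closed)
    qed
    then show ?thesis using a(2) by (simp add: B_def)
  qed
  have closed: "b \<in> B" if u: "\<And>k. u k \<in> B" and b: "norm_tendsto A (cnorm A) u b" "b \<in> carrier A" for u b
  proof -
    have u_closed: "u k \<in> carrier A" for k using u[of k] B_sub by blast
    \<comment> \<open>At a fixed vector the action is a bounded linear map of the algebra element,
      by \<open>unital_star_rep_bounded\<close>. The space is arbitrary because the limit is taken
      in \<open>H\<close> as well as in \<open>K\<close>.\<close>
    have lim: "norm_tendsto L (hnorm L) (\<lambda>k. \<theta> (u k) z) (\<theta> b z)"
      if rep: "unital_star_rep A (L, \<theta>)" and z: "z \<in> carrier L" for L :: "'z hilbert" and \<theta> z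
    proof (rule norm_tendsto_linear[OF A.normed_module_axioms _ _ _ b(1) u_closed b(2)])
      interpret L: hilbert_space L by (rule unital_star_repD(1)[OF rep])
      show "normed_module L (hnorm L)" by (rule L.normed_module_axioms)
      show "linear_on A L (\<lambda>a. \<theta> a z)"
        using z unital_star_repD(3,4)[OF rep] linear_on_closed[OF unital_star_repD(2)[OF rep]]
        by (simp add: linear_on_def[of A])
      show "hnorm L (\<theta> a z) \<le> 2 * hnorm L z * cnorm A a" if "a \<in> carrier A" for a
        using unital_star_rep_bounded[OF alg rep that z] by (simp add: mult_ac)
    qed
    have "U (\<pi> b x) = \<rho> b (U x)" if x: "x \<in> carrier H" for x
    proof (rule K.norm_tendsto_unique)
      show "norm_tendsto K (hnorm K) (\<lambda>k. U (\<pi> (u k) x)) (U (\<pi> b x))"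
        using x u_closed b(2)
        by (intro norm_tendsto_linear[OF H.normed_module_axioms K.normed_module_axioms lin, where C = 1]
            lim[OF H]) (simp_all add: norm_U \<pi>_closed)
      have "U (\<pi> (u k) x) = \<rho> (u k) (U x)" for k using u[of k] x by (simp add: B_def)
      then show "norm_tendsto K (hnorm K) (\<lambda>k. U (\<pi> (u k) x)) (\<rho> b (U x))"
        using lim[OF K U_closed[OF x]] by simp
    qed (use x u_closed b(2) in \<open>simp_all add: U_closed \<pi>_closed \<rho>_closed\<close>)
    then show ?thesis using b(2) by (simp add: B_def)
  qed
  have uminus: "\<ominus>\<^bsub>A\<^esub> a \<in> B" if "a \<in> B" for a
    using smult[OF that, of "- 1"] that B_sub by (auto simp: A.uminus_eq_smult)
  have zero: "\<zero>\<^bsub>A\<^esub> \<in> B"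
    using smult[OF one, of 0] by simp
  have "closed_submodule A (cnorm A) B"
    by (rule A.closed_submoduleI) (fact B_sub zero add smult closed)+
  moreover have "subring B A"
    by (rule A.subringI) (fact B_sub one uminus mult add)+
  ultimately have "cstar_subalgebra A B"
    using star by (simp add: cstar_subalgebra_def closed_submodule_def)
  moreover have "s ` {1..M} \<subseteq> B" using s gen by (auto simp: B_def)
  ultimately have "B = carrier A" by (rule univ)
  then show ?thesis using a x by (auto simp: B_def)
qed

section \<open>The relabelling automorphism\<close>

text \<open>The universal property yields endomorphisms, while \<open>alpha\<close> is described
  among automorphisms. The inverse is the endomorphism of the opposite relabelling: both composites
  fix the generators and hence are the identity by \<open>cuntz_algebra_hom_eq\<close>.\<close>

lemma alpha:
  assumes A: "cuntz_algebra (\<Prod>i=1..n. N i) A s" and n: "n \<ge> 1"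
    and \<sigma>: "\<sigma> permutes {1..n}" and \<eta>: "\<eta> permutes {1..n}"
  shows "star_hom A A (alpha A s N n \<sigma> \<eta>)"
    and "i \<in> (\<Pi>\<^sub>E k\<in>{1..n}. {1..N k}) \<Longrightarrow>
      alpha A s N n \<sigma> \<eta> (s (multi_index N n \<eta> i)) = s (multi_index N n \<sigma> i)"
proof -
  define M where "M = (\<Prod>i=1..n. N i)"
  let ?I = "\<Pi>\<^sub>E k\<in>{1..n}. {1..N k}"
  let ?m\<sigma> = "multi_index N n \<sigma>" and ?m\<eta> = "multi_index N n \<eta>"
  note A = A[folded M_def]
  have alg: "unital_cstar_algebra A" and fam: "cuntz_family M A s"
    using A by (auto simp: cuntz_algebra_def)
  have gen: "s k \<in> carrier A" if "k \<in> {1..M}" for k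
    using fam that by (auto simp: cuntz_family_def)
  interpret A: unital_cstar_algebra A by (rule alg)
  have b\<sigma>: "bij_betw ?m\<sigma> ?I {1..M}" and b\<eta>: "bij_betw ?m\<eta> ?I {1..M}"
    unfolding M_def by (rule multi_index_bij[OF n \<sigma>] multi_index_bij[OF n \<eta>])+
  \<comment> \<open>Decode a generator number as a multi-index in one order and encode it in the
    other.\<close>
  define p q where "p = ?m\<sigma> \<circ> inv_into ?I ?m\<eta>" and "q = ?m\<eta> \<circ> inv_into ?I ?m\<sigma>"
  have p: "bij_betw p {1..M} {1..M}"
    unfolding p_def by (rule bij_betw_trans[OF bij_betw_inv_into[OF b\<eta>] b\<sigma>])
  have q: "bij_betw q {1..M} {1..M}"
    unfolding q_def by (rule bij_betw_trans[OF bij_betw_inv_into[OF b\<sigma>] b\<eta>])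
  have p_eq: "p (?m\<eta> i) = ?m\<sigma> i" and q_eq: "q (?m\<sigma> i) = ?m\<eta> i" if "i \<in> ?I" for i
    using that bij_betw_inv_into_left[OF b\<eta>] bij_betw_inv_into_left[OF b\<sigma>] by (simp_all add: p_def q_def)
  have qp: "q (p k) = k" and pq: "p (q k) = k" if k: "k \<in> {1..M}" for k
  proof -
    obtain i j where ij: "i \<in> ?I" "?m\<eta> i = k" "j \<in> ?I" "?m\<sigma> j = k"
      using b\<sigma> b\<eta> k by (metis (no_types, lifting) bij_betw_imp_surj_on imageE)
    then show "q (p k) = k" "p (q k) = k"
      using ij p_eq[OF ij(1)] q_eq[OF ij(1)] p_eq[OF ij(3)] q_eq[OF ij(3)] by simp_all
  qed
  have p_in: "p k \<in> {1..M}" and q_in: "q k \<in> {1..M}" if "k \<in> {1..M}" for k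
    using that p q by (auto dest: bij_betwE simp del: atLeastAtMost_iff)
  have fam_p: "cuntz_family M A (\<lambda>k. s (p k))" and fam_q: "cuntz_family M A (\<lambda>k. s (q k))"
    using cuntz_family_permute[OF alg fam] p q by blast+
  have univ: "\<exists>!f. f \<in> extensional (carrier A) \<and> star_hom A A f \<and> (\<forall>k\<in>{1..M}. f (s k) = t k)"
    if "cuntz_family M A t" for t
    using A that alg by (simp add: cuntz_algebra_def)
  obtain f where f: "f \<in> extensional (carrier A)" "star_hom A A f" "\<forall>k\<in>{1..M}. f (s k) = s (p k)"
    using univ[OF fam_p] by blast
  obtain g where g: "star_hom A A g" "\<forall>k\<in>{1..M}. g (s k) = s (q k)"
    using univ[OF fam_q] by blast
  have id: "star_hom A A (\<lambda>x. x)"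
    by (simp add: star_hom_def ring_hom_def linear_on_def)
  have gf: "g (f a) = a" and fg: "f (g a) = a" if "a \<in> carrier A" for a
    by (rule cuntz_algebra_hom_eq[OF A alg fam star_hom_comp[OF f(2) g(1)] _ id _ that]
        cuntz_algebra_hom_eq[OF A alg fam star_hom_comp[OF g(1) f(2)] _ id _ that];
        use f(3) g(2) p_in q_in qp pq in \<open>simp del: atLeastAtMost_iff\<close>)+
  have "f a \<in> carrier A" "g a \<in> carrier A" if "a \<in> carrier A" for a
    using that f(2) g(1) by (auto simp: star_hom_def linear_on_def)
  then have "bij_betw f (carrier A) (carrier A)"
    using gf fg by (intro bij_betw_byWitness[of _ g]) auto
  then have auto_f: "star_automorphism A f" using f(2) by (simp add: star_automorphism_def)
  let ?P = "\<lambda>f. f \<in> extensional (carrier A) \<and> star_automorphism A f \<and>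
    (\<forall>i\<in>?I. f (s (?m\<eta> i)) = s (?m\<sigma> i))"
  have "?P f"
    using f auto_f p_eq bij_betwE[OF b\<eta>] by auto
  \<comment> \<open>The multi-indices reach every generator number, so \<open>h\<close> satisfies
    the condition that determines \<open>f\<close> among all homomorphisms.\<close>
  moreover have "h = f" if "?P h" for h
  proof -
    have "h (s k) = s (p k)" if k: "k \<in> {1..M}" for k
    proof -
      obtain i where "i \<in> ?I" "?m\<eta> i = k"
        using b\<eta> k by (metis (no_types, lifting) bij_betw_imp_surj_on imageE)
      then show ?thesis using \<open>?P h\<close> p_eq by auto
    qed
    then show ?thesis
      using univ[OF fam_p] that f by (auto simp: star_automorphism_def)
  qed
  ultimately have "?P (alpha A s N n \<sigma> \<eta>)"
    unfolding alpha_def by (rule theI)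
  then show "star_hom A A (alpha A s N n \<sigma> \<eta>)"
    and "i \<in> ?I \<Longrightarrow> alpha A s N n \<sigma> \<eta> (s (?m\<eta> i)) = s (?m\<sigma> i)"
    by (auto simp: star_automorphism_def)
qed

section \<open>Permuted products\<close>

lemma image_comp_permutes:
  assumes "\<sigma> permutes S"
  shows "(\<lambda>x k. x (\<sigma> k)) ` {x. \<forall>k\<in>S. x k \<in> C k} = {y. \<forall>k\<in>S. y k \<in> C (\<sigma> k)}"
proof (intro equalityI subsetI)
  fix y assume y: "y \<in> {y. \<forall>k\<in>S. y k \<in> C (\<sigma> k)}"
  have "inv_into UNIV \<sigma> k \<in> S" "\<sigma> (inv_into UNIV \<sigma> k) = k" if "k \<in> S" for k
    using permutes_in_image[OF permutes_inv[OF assms]] permutes_inverses(1)[OF assms] that by auto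
  then have "y (inv_into UNIV \<sigma> k) \<in> C k" if "k \<in> S" for k
    using y that by fastforce
  moreover have "y = (\<lambda>k. y (inv_into UNIV \<sigma> (\<sigma> k)))"
    using permutes_inverses(2)[OF assms] by simp
  ultimately show "y \<in> (\<lambda>x k. x (\<sigma> k)) ` {x. \<forall>k\<in>S. x k \<in> C k}"
    by (intro image_eqI[where x = "\<lambda>k. y (inv_into UNIV \<sigma> k)"]) auto
qed (use permutes_in_image[OF assms] in auto)

text \<open>Everything is expressed in the original numbering of the factors. The permutation is
  absorbed into \<open>e\<close> and stays visible only in the label
  \<open>multi_index N n \<sigma> i\<close>, so that the Gram matrix and the action on tuples are
  given by the same formulas for all permutations.\<close>

lemma phi_product_permuted:
  fixes Oc :: "nat \<Rightarrow> 'a cstar" and N :: "nat \<Rightarrow> nat" and n :: nat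
    and \<pi> :: "nat \<Rightarrow> ('a, 'h) rep"
  defines "M \<equiv> (\<Prod>i=1..n. N i)"
  assumes cuntz: "\<And>k. k \<ge> 2 \<Longrightarrow> cuntz_algebra k (Oc k) (s k)"
    and n: "n \<ge> 1"
    and N: "\<And>i. i \<in> {1..n} \<Longrightarrow> N i \<ge> 2"
    and \<sigma>: "\<sigma> permutes {1..n}"
    and reps: "\<And>i. i \<in> {1..n} \<Longrightarrow> unital_star_rep (Oc (N i)) (\<pi> i)"
    and prod: "phi_product Oc s (map (\<lambda>i. (N (\<sigma> i), \<pi> (\<sigma> i))) [1..<n+1]) (M, (H, \<rho>))"
  obtains e where "2 \<le> M" "unital_star_rep (Oc M) (H, \<rho>)"
    and "total H (hnorm H) (e ` {x. \<forall>k\<in>{1..n}. x k \<in> carrier (fst (\<pi> k))})"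
    and "\<And>x y. \<lbrakk>\<forall>k\<in>{1..n}. x k \<in> carrier (fst (\<pi> k)); \<forall>k\<in>{1..n}. y k \<in> carrier (fst (\<pi> k))\<rbrakk> \<Longrightarrow>
      iprod H (e x) (e y) = (\<Prod>k=1..n. iprod (fst (\<pi> k)) (x k) (y k))"
    and "\<And>i x. \<lbrakk>i \<in> (\<Pi>\<^sub>E k\<in>{1..n}. {1..N k}); \<forall>k\<in>{1..n}. x k \<in> carrier (fst (\<pi> k))\<rbrakk> \<Longrightarrow>
      \<rho> (s M (multi_index N n \<sigma> i)) (e x) = e (\<lambda>k. snd (\<pi> k) (s (N k) (i k)) (x k))"
proof -
  have \<sigma>_in: "\<sigma> k \<in> {1..n}" if "k \<in> {1..n}" for k
    using permutes_in_image[OF \<sigma>, of k] that by simp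
  have "N (\<sigma> k) \<ge> 2" "unital_star_rep (Oc (N (\<sigma> k))) (\<pi> (\<sigma> k))" if "k \<in> {1..n}" for k
    using N reps \<sigma>_in[OF that] by blast+
  from phi_product_tensor[OF cuntz n this prod]
  obtain E where M: "2 \<le> M" and rep: "unital_star_rep (Oc M) (H, \<rho>)"
    and E: "multi_tensor n (\<lambda>k. fst (\<pi> (\<sigma> k))) H E"
    and act: "\<And>i x. (\<forall>k\<in>{1..n}. i k \<in> {1..N (\<sigma> k)} \<and> x k \<in> carrier (fst (\<pi> (\<sigma> k)))) \<Longrightarrow>
        \<rho> (s M (mixed_index (\<lambda>k. N (\<sigma> k)) i n)) (E x) =
        E (\<lambda>k. snd (\<pi> (\<sigma> k)) (s (N (\<sigma> k)) (i k)) (x k))"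
    by auto
  \<comment> \<open>The factor in position \<open>k\<close> of the product is the one numbered
    \<open>\<sigma> k\<close>, so \<open>E\<close> expects the vector \<open>x (\<sigma> k)\<close>
    there.\<close>
  define e where "e x = E (\<lambda>k. x (\<sigma> k))" for x
  show ?thesis
  proof (rule that[OF M rep])
    have "e ` {x. \<forall>k\<in>{1..n}. x k \<in> carrier (fst (\<pi> k))} =
        E ` {y. \<forall>k\<in>{1..n}. y k \<in> carrier (fst (\<pi> (\<sigma> k)))}"
      unfolding e_def image_comp_permutes[OF \<sigma>, of "\<lambda>k. carrier (fst (\<pi> k))", symmetric] by auto
    then show "total H (hnorm H) (e ` {x. \<forall>k\<in>{1..n}. x k \<in> carrier (fst (\<pi> k))})"
      using multi_tensorD(3)[OF E] by simp
  next
    fix x y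
    assume xy: "\<forall>k\<in>{1..n}. x k \<in> carrier (fst (\<pi> k))" "\<forall>k\<in>{1..n}. y k \<in> carrier (fst (\<pi> k))"
    have "iprod H (e x) (e y) = (\<Prod>k=1..n. iprod (fst (\<pi> (\<sigma> k))) (x (\<sigma> k)) (y (\<sigma> k)))"
      unfolding e_def using xy \<sigma>_in by (intro multi_tensorD(2)[OF E]) blast+
    also have "\<dots> = (\<Prod>k=1..n. iprod (fst (\<pi> k)) (x k) (y k))"
      using prod.permute[OF \<sigma>, of "\<lambda>k. iprod (fst (\<pi> k)) (x k) (y k)"] by (simp add: comp_def)
    finally show "iprod H (e x) (e y) = (\<Prod>k=1..n. iprod (fst (\<pi> k)) (x k) (y k))" .
  next
    fix i x
    assume "i \<in> (\<Pi>\<^sub>E k\<in>{1..n}. {1..N k})" "\<forall>k\<in>{1..n}. x k \<in> carrier (fst (\<pi> k))"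
    then have "\<forall>k\<in>{1..n}. i (\<sigma> k) \<in> {1..N (\<sigma> k)} \<and> x (\<sigma> k) \<in> carrier (fst (\<pi> (\<sigma> k)))"
      using \<sigma>_in by blast
    then show "\<rho> (s M (multi_index N n \<sigma> i)) (e x) = e (\<lambda>k. snd (\<pi> k) (s (N k) (i k)) (x k))"
      unfolding e_def multi_index_eq_mixed_index[OF n] by (rule act)
  qed
qed

section \<open>Equivalence of two permuted products\<close>

lemma linear_on_comp: "\<lbrakk>linear_on U V f; linear_on V W g\<rbrakk> \<Longrightarrow> linear_on U W (\<lambda>x. g (f x))"
  by (auto simp: linear_on_def Pi_iff)

theorem theorem1p3:
  fixes Oc :: "nat \<Rightarrow> 'a cstar" and s :: "nat \<Rightarrow> nat \<Rightarrow> 'a"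
    and n :: nat and N :: "nat \<Rightarrow> nat" and \<sigma> \<eta> :: "nat \<Rightarrow> nat"
    and \<pi> :: "nat \<Rightarrow> ('a, 'h) rep" and R\<sigma> R\<eta> :: "('a, 'h) rep"
  defines "M \<equiv> (\<Prod>i=1..n. N i)"
  assumes cuntz: "\<And>k. k \<ge> 2 \<Longrightarrow> cuntz_algebra k (Oc k) (s k)"
    and n: "n \<ge> 2"
    and N: "\<And>i. i \<in> {1..n} \<Longrightarrow> N i \<ge> 2"
    and \<sigma>: "\<sigma> permutes {1..n}"
    and \<eta>: "\<eta> permutes {1..n}"
    and reps: "\<And>i. i \<in> {1..n} \<Longrightarrow> unital_star_rep (Oc (N i)) (\<pi> i)"
    and prod_\<sigma>: "phi_product Oc s (map (\<lambda>i. (N (\<sigma> i), \<pi> (\<sigma> i))) [1..<n+1]) (M, R\<sigma>)"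
    and prod_\<eta>: "phi_product Oc s (map (\<lambda>i. (N (\<eta> i), \<pi> (\<eta> i))) [1..<n+1]) (M, R\<eta>)"
  shows "unitarily_equivalent (Oc M) R\<sigma> (rep_comp R\<eta> (alpha (Oc M) (s M) N n \<eta> \<sigma>))"
proof -
  obtain H \<rho> where R\<sigma>: "R\<sigma> = (H, \<rho>)" by (cases R\<sigma>)
  obtain K \<theta> where R\<eta>: "R\<eta> = (K, \<theta>)" by (cases R\<eta>)
  have n1: "n \<ge> 1" using n by simp
  define I where "I = {x. \<forall>k\<in>{1..n}. x k \<in> carrier (fst (\<pi> k))}"
  \<comment> \<open>The factorwise action of the generator labelled by \<open>i\<close> on a tuple.
    No permutation enters, so both products share it.\<close>
  define T where "T i x k = snd (\<pi> k) (s (N k) (i k)) (x k)" for i :: "nat \<Rightarrow> nat" and x :: "nat \<Rightarrow> 'h" and k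
  have T_in: "T i x \<in> I" if i: "i \<in> (\<Pi>\<^sub>E k\<in>{1..n}. {1..N k})" and x: "x \<in> I" for i x
  proof -
    have "T i x k \<in> carrier (fst (\<pi> k))" if k: "k \<in> {1..n}" for k
    proof -
      have gen: "s (N k) (i k) \<in> carrier (Oc (N k))"
        using cuntz[OF N[OF k]] i k by (auto simp: cuntz_algebra_def cuntz_family_def)
      have "unital_star_rep (Oc (N k)) (fst (\<pi> k), snd (\<pi> k))" using reps[OF k] by simp
      from linear_on_closed[OF unital_star_repD(2)[OF this gen], of "x k"] show ?thesis
        using x k by (simp add: T_def I_def)
    qed
    then show ?thesis by (simp add: I_def)
  qed
  obtain e where M2: "2 \<le> M" and rep_\<sigma>: "unital_star_rep (Oc M) (H, \<rho>)"
    and total_e: "total H (hnorm H) (e ` I)"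
    and gram_e: "\<And>x y. \<lbrakk>x \<in> I; y \<in> I\<rbrakk> \<Longrightarrow> iprod H (e x) (e y) = (\<Prod>k=1..n. iprod (fst (\<pi> k)) (x k) (y k))"
    and act_e: "\<And>i x. \<lbrakk>i \<in> (\<Pi>\<^sub>E k\<in>{1..n}. {1..N k}); x \<in> I\<rbrakk> \<Longrightarrow>
      \<rho> (s M (multi_index N n \<sigma> i)) (e x) = e (T i x)"
    using phi_product_permuted[OF cuntz n1 N \<sigma> reps prod_\<sigma>[unfolded R\<sigma> M_def], folded M_def]
    unfolding I_def T_def by auto
  obtain f where "2 \<le> M" and rep_\<eta>: "unital_star_rep (Oc M) (K, \<theta>)"
    and total_f: "total K (hnorm K) (f ` I)"
    and gram_f: "\<And>x y. \<lbrakk>x \<in> I; y \<in> I\<rbrakk> \<Longrightarrow> iprod K (f x) (f y) = (\<Prod>k=1..n. iprod (fst (\<pi> k)) (x k) (y k))"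
    and act_f: "\<And>i x. \<lbrakk>i \<in> (\<Pi>\<^sub>E k\<in>{1..n}. {1..N k}); x \<in> I\<rbrakk> \<Longrightarrow>
      \<theta> (s M (multi_index N n \<eta> i)) (f x) = f (T i x)"
    using phi_product_permuted[OF cuntz n1 N \<eta> reps prod_\<eta>[unfolded R\<eta> M_def], folded M_def]
    unfolding I_def T_def by auto
  let ?\<alpha> = "alpha (Oc M) (s M) N n \<eta> \<sigma>"
  note A = cuntz[OF M2]
  then have alg: "unital_cstar_algebra (Oc M)" by (simp add: cuntz_algebra_def)
  note \<alpha> = alpha[OF A[unfolded M_def] n1 \<eta> \<sigma>, folded M_def]
  have rep_\<alpha>: "unital_star_rep (Oc M) (K, \<theta> \<circ> ?\<alpha>)"
    using unital_star_rep_comp[OF \<alpha>(1) rep_\<eta>] by (simp add: rep_comp_def)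
  interpret H: hilbert_space H by (rule unital_star_repD(1)[OF rep_\<sigma>])
  interpret K: hilbert_space K by (rule unital_star_repD(1)[OF rep_\<eta>])
  have gram: "\<forall>x\<in>I. \<forall>y\<in>I. iprod H (e x) (e y) = iprod K (f x) (f y)"
    by (simp add: gram_e gram_f)
  obtain U where U: "unitary H K U" and U_e: "\<And>x. x \<in> I \<Longrightarrow> U (e x) = f x"
    using unitary_of_gram[OF H.hilbert_space_axioms K.hilbert_space_axioms total_e total_f gram] by blast
  have lin_U: "linear_on H K U" and norm_U: "\<And>x. x \<in> carrier H \<Longrightarrow> hnorm K (U x) = hnorm H x"
    using U by (auto simp: unitary_def hnorm_def)
  have gen: "U (\<rho> (s M j) x) = (\<theta> \<circ> ?\<alpha>) (s M j) (U x)" if j: "j \<in> {1..M}" and x: "x \<in> carrier H" for j x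
  proof -
    have s_j: "s M j \<in> carrier (Oc M)" using A j by (auto simp: cuntz_algebra_def cuntz_family_def)
    note lin_\<rho> = unital_star_repD(2)[OF rep_\<sigma> s_j] and lin_\<theta> = unital_star_repD(2)[OF rep_\<alpha> s_j]
    \<comment> \<open>Every generator carries the \<sigma>-label of some multi-index; the
      automorphism replaces it by the \<eta>-label of the same multi-index.\<close>
    obtain i where i: "i \<in> (\<Pi>\<^sub>E k\<in>{1..n}. {1..N k})" "multi_index N n \<sigma> i = j"
      using multi_index_bij[OF n1 \<sigma>, of N, folded M_def] j
      by (metis (no_types, lifting) bij_betw_imp_surj_on imageE)
    \<comment> \<open>Both sides are bounded linear in the vector, so it suffices to compare them on
      the total set of tensors \<open>e x\<close>, where both give \<open>f (T i x)\<close>.\<close>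
    show ?thesis
    proof (rule linear_eq_on_total[OF H.normed_module_axioms K.normed_module_axioms
          linear_on_comp[OF lin_\<rho> lin_U] _ linear_on_comp[OF lin_U lin_\<theta>] _ total_e _ x])
      show "hnorm K (U (\<rho> (s M j) x)) \<le> 2 * cnorm (Oc M) (s M j) * hnorm H x" if "x \<in> carrier H" for x
        using unital_star_rep_bounded[OF alg rep_\<sigma> s_j that] linear_on_closed[OF lin_\<rho> that]
        by (simp add: norm_U)
      show "hnorm K ((\<theta> \<circ> ?\<alpha>) (s M j) (U x)) \<le> 2 * cnorm (Oc M) (s M j) * hnorm H x" if "x \<in> carrier H" for x
        using unital_star_rep_bounded[OF alg rep_\<alpha> s_j linear_on_closed[OF lin_U that]]
        by (simp add: norm_U that)
      fix z assume "z \<in> e ` I"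
      then obtain x where x: "x \<in> I" "z = e x" by blast
      have "U (\<rho> (s M j) z) = f (T i x)"
        using x i act_e U_e T_in by auto
      moreover have "(\<theta> \<circ> ?\<alpha>) (s M j) (U z) = f (T i x)"
        using x i \<alpha>(2)[OF i(1)] act_f U_e by auto
      ultimately show "U (\<rho> (s M j) z) = (\<theta> \<circ> ?\<alpha>) (s M j) (U z)" by simp
    qed
  qed
  have "U (\<rho> a x) = (\<theta> \<circ> ?\<alpha>) a (U x)" if "a \<in> carrier (Oc M)" "x \<in> carrier H" for a x
    using unital_star_rep_intertwiner[OF A rep_\<sigma> rep_\<alpha> U gen that] .
  then show ?thesis
    using U by (auto simp: unitarily_equivalent_def R\<sigma> R\<eta> rep_comp_def)
qed

end
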